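(* Let $G_0$ be the (finitely presented, nonamenable) Lodha–Moore group of piecewise projective homeomorphisms of the real line. Then $H^2_b(H;\mathbf{R})=0$ for every subgroup $H\le G_0$.
   Context: $H^2_b(H;\mathbf{R})$ is the second bounded cohomology of the discrete group $H$ with trivial real coefficients: bounded functions $\omega:H^2\to\mathbf{R}$ with $\omega(g_2,g_3)-\omega(g_1g_2,g_3)+\omega(g_1,g_2g_3)-\omega(g_1,g_2)=0$, modulo functions $(g,h)\mapsto\phi(g)+\phi(h)-\phi(gh)$ with $\phi:H\to\mathbf{R}$ bounded. $G_0=\langle a,b,c\rangle\le\mathrm{Homeo}^+(\mathbf{R})$, where $a(t)=t+1$; $b(t)=t$ if $t\le0$, $b(t)=\frac{t}{1-t}$ if $0\le t\le\frac12$, $b(t)=3-\frac1t$ if $\frac12\le t\le1$, $b(t)=t+1$ if $t\ge1$; $c(t)=\frac{2t}{1+t}$ if $0\le t\le1$ and $c(t)=t$ otherwise. It is known from earlier work of Lodha and Moore that $G_0$ is finitely presented and nonamenable. *)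

theory Defs
  imports "HOL-Analysis.Analysis" "HOL-Algebra.Elementary_Groups"
begin

definition bounded_2cocycles :: "('a, 'b) monoid_scheme \<Rightarrow> ('a \<times> 'a \<Rightarrow> real) set" where
  "bounded_2cocycles G =
    {\<omega> \<in> carrier G \<times> carrier G \<rightarrow>\<^sub>E UNIV.
       bounded (\<omega> ` (carrier G \<times> carrier G)) \<and>
       (\<forall>g1\<in>carrier G. \<forall>g2\<in>carrier G. \<forall>g3\<in>carrier G.
          \<omega> (g2, g3) - \<omega> (g1 \<otimes>\<^bsub>G\<^esub> g2, g3) + \<omega> (g1, g2 \<otimes>\<^bsub>G\<^esub> g3) - \<omega> (g1, g2) = 0)}"

definition bounded_2coboundaries :: "('a, 'b) monoid_scheme \<Rightarrow> ('a \<times> 'a \<Rightarrow> real) set" where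
  "bounded_2coboundaries G =
    {\<lambda>(g, h)\<in>carrier G \<times> carrier G. \<phi> g + \<phi> h - \<phi> (g \<otimes>\<^bsub>G\<^esub> h) | \<phi> :: 'a \<Rightarrow> real.
       bounded (\<phi> ` carrier G)}"

definition bounded_2cocycle_group :: "('a, 'b) monoid_scheme \<Rightarrow> ('a \<times> 'a \<Rightarrow> real) monoid" where
  "bounded_2cocycle_group G =
    \<lparr>carrier = bounded_2cocycles G,
     monoid.mult = (\<lambda>\<omega> \<omega>'. \<lambda>p\<in>carrier G \<times> carrier G. \<omega> p + \<omega>' p),
     one = (\<lambda>p\<in>carrier G \<times> carrier G. 0)\<rparr>"

text \<open>The second bounded cohomology with trivial real coefficients, as an additive group
  (its real vector space structure plays no role for its vanishing).\<close>

definition second_bounded_cohomology ::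
    "('a, 'b) monoid_scheme \<Rightarrow> ('a \<times> 'a \<Rightarrow> real) set monoid" where
  "second_bounded_cohomology G = bounded_2cocycle_group G Mod bounded_2coboundaries G"

text \<open>The product of the group is composition of functions, \<^term>\<open>f \<circ> g\<close> (left action).\<close>

definition Homeo_plus_R :: "(real \<Rightarrow> real) monoid" where
  "Homeo_plus_R =
    \<lparr>carrier = {f. strict_mono f \<and> (\<exists>g. homeomorphism UNIV UNIV f g)},
     monoid.mult = (\<circ>),
     one = id\<rparr>"

definition lm_a :: "real \<Rightarrow> real" where
  "lm_a t = t + 1"

definition lm_b :: "real \<Rightarrow> real" where
  "lm_b t =
    (if t \<le> 0 then t
     else if t \<le> 1/2 then t / (1 - t)
     else if t \<le> 1 then 3 - 1 / t
     else t + 1)"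

definition lm_c :: "real \<Rightarrow> real" where
  "lm_c t = (if 0 \<le> t \<and> t \<le> 1 then 2 * t / (1 + t) else t)"

text \<open>\<^const>\<open>subgroup_generated\<close> intersects the generating set with the carrier; that nothing is
  lost here is the fact \<open>lm_generators_in_Homeo_plus_R\<close> below.\<close>

definition Lodha_Moore_G0 :: "(real \<Rightarrow> real) monoid" where
  "Lodha_Moore_G0 = subgroup_generated Homeo_plus_R {lm_a, lm_b, lm_c}"

lemma homeo_plus_RI:
  fixes f g :: "real \<Rightarrow> real"
  assumes mono_f: "mono f" and gf: "\<And>x. g (f x) = x" and fg: "\<And>x. f (g x) = x"
  shows "f \<in> carrier Homeo_plus_R"
proof -
  have inj: "inj f" and surj: "surj f" "surj g"
    using gf fg by (metis injI, metis surjI, metis surjI)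
  have sm: "strict_mono f"
    using mono_f inj by (simp add: strict_mono_iff_mono)
  have mono_g: "mono g"
    by (rule monoI) (metis fg sm strict_mono_less_eq)
  have c: "continuous_on UNIV h" if "mono h" "surj h" for h :: "real \<Rightarrow> real"
  proof -
    have "open (h ` UNIV)" using that(2) by simp
    moreover have "\<And>x y. x \<in> UNIV \<Longrightarrow> y \<in> UNIV \<Longrightarrow> x \<le> y \<Longrightarrow> h x \<le> h y"
      using that(1) by (simp add: monoD)
    ultimately show ?thesis
      by (rule continuous_onI_mono)
  qed
  have "homeomorphism UNIV UNIV f g"
    unfolding homeomorphism_def using mono_f mono_g gf fg surj c by auto
  then show ?thesis
    using sm by (auto simp: Homeo_plus_R_def)
qed

lemma group_Homeo_plus_R: "group Homeo_plus_R"
proof (rule groupI)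
  fix f g assume "f \<in> carrier Homeo_plus_R" "g \<in> carrier Homeo_plus_R"
  then show "f \<otimes>\<^bsub>Homeo_plus_R\<^esub> g \<in> carrier Homeo_plus_R"
    by (auto simp: Homeo_plus_R_def strict_mono_def intro: homeomorphism_compose)
next
  show "\<one>\<^bsub>Homeo_plus_R\<^esub> \<in> carrier Homeo_plus_R"
    by (auto simp: Homeo_plus_R_def strict_mono_def id_def intro!: exI homeomorphism_ident)
next
  fix f assume f: "f \<in> carrier Homeo_plus_R"
  then obtain g where sm: "strict_mono f" and g: "homeomorphism UNIV UNIV f g"
    by (auto simp: Homeo_plus_R_def)
  have gf: "\<And>x. g (f x) = x" and fg: "\<And>x. f (g x) = x"
    using g by (auto simp: homeomorphism_def)
  have "mono g"
    by (rule monoI) (metis fg sm strict_mono_less_eq)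
  then have "g \<in> carrier Homeo_plus_R"
    using gf fg by (intro homeo_plus_RI)
  moreover have "g \<otimes>\<^bsub>Homeo_plus_R\<^esub> f = \<one>\<^bsub>Homeo_plus_R\<^esub>"
    using gf by (auto simp: Homeo_plus_R_def)
  ultimately show "\<exists>g\<in>carrier Homeo_plus_R. g \<otimes>\<^bsub>Homeo_plus_R\<^esub> f = \<one>\<^bsub>Homeo_plus_R\<^esub>"
    by blast
qed (auto simp: Homeo_plus_R_def comp_assoc)

lemma lm_generators_in_Homeo_plus_R: "{lm_a, lm_b, lm_c} \<subseteq> carrier Homeo_plus_R"
proof -
  have "lm_a \<in> carrier Homeo_plus_R"
    by (rule homeo_plus_RI[where g = "\<lambda>t. t - 1"]) (auto simp: lm_a_def mono_def)
  moreover have "lm_b \<in> carrier Homeo_plus_R"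
  proof (rule homeo_plus_RI)
    let ?g = "\<lambda>t::real. if t \<le> 0 then t else if t \<le> 1 then t / (1 + t)
      else if t \<le> 2 then 1 / (3 - t) else t - 1"
    show "?g (lm_b t) = t" for t
      by (auto simp: lm_b_def field_simps)
    show "lm_b (?g t) = t" for t
    proof -
      consider "t \<le> 0" | "0 < t" "t \<le> 1" | "1 < t" "t \<le> 2" | "2 < t" by linarith
      then show ?thesis
      proof cases
        case 2
        then have "0 < t / (1 + t)" by simp
        moreover have "t / (1 + t) \<le> 1 / 2" "1 - t / (1 + t) = 1 / (1 + t)"
          using 2 by (simp_all add: field_simps)
        moreover have "lm_b u = u / (1 - u)" if "0 < u" "u \<le> 1 / 2" for u
          using that by (simp add: lm_b_def)
        ultimately have "lm_b (t / (1 + t)) = t" using 2 by simp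
        with 2 show ?thesis by simp
      next
        case 3
        then have "1 / 2 < 1 / (3 - t)" "1 / (3 - t) \<le> 1"
          by (simp_all add: field_simps)
        with 3 show ?thesis by (simp add: lm_b_def)
      qed (simp_all add: lm_b_def)
    qed
    show "mono lm_b"
    proof (rule monoI)
      fix x y :: real assume xy: "x \<le> y"
      have 1: "s / (1 - s) \<le> 1" "0 \<le> s / (1 - s)" if "0 < s" "s \<le> 1/2" for s :: real
        using that by (simp_all add: field_simps)
      have 2: "1 \<le> 3 - 1 / s" "3 - 1 / s \<le> 2" if "1/2 < s" "s \<le> 1" for s :: real
        using that by (simp_all add: field_simps)
      have 3: "x / (1 - x) \<le> y / (1 - y)" if "0 < x" "y \<le> 1/2"
        using that xy by (intro frac_le) auto
      have 4: "1 / y \<le> 1 / x" if "0 < x"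
        using that xy by (intro divide_left_mono) auto
      show "lm_b x \<le> lm_b y"
        using xy 1[of x] 1[of y] 2[of x] 2[of y] 3 4 unfolding lm_b_def by (smt (verit))
    qed
  qed
  moreover have "lm_c \<in> carrier Homeo_plus_R"
  proof (rule homeo_plus_RI)
    let ?g = "\<lambda>t::real. if 0 \<le> t \<and> t \<le> 1 then t / (2 - t) else t"
    show "?g (lm_c t) = t" for t
    proof (cases "0 \<le> t \<and> t \<le> 1")
      case True
      then have "0 \<le> 2 * t / (1 + t)" "2 * t / (1 + t) \<le> 1" "2 - 2 * t / (1 + t) = 2 / (1 + t)"
        by (simp_all add: field_simps)
      with True show ?thesis by (simp add: lm_c_def)
    qed (auto simp: lm_c_def)
    show "lm_c (?g t) = t" for t
    proof (cases "0 \<le> t \<and> t \<le> 1")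
      case True
      then have "0 \<le> t / (2 - t)" "t / (2 - t) \<le> 1" "1 + t / (2 - t) = 2 / (2 - t)"
        by (simp_all add: field_simps)
      with True show ?thesis by (simp add: lm_c_def)
    qed (auto simp: lm_c_def)
    show "mono lm_c"
    proof (rule monoI)
      fix x y :: real assume xy: "x \<le> y"
      have 1: "2 * s / (1 + s) \<le> 1" "0 \<le> 2 * s / (1 + s)" if "0 \<le> s" "s \<le> 1" for s :: real
        using that by (simp_all add: field_simps)
      have 2: "2 * x / (1 + x) \<le> 2 * y / (1 + y)" if "0 \<le> x" 
        using that xy by (simp add: field_simps)
      show "lm_c x \<le> lm_c y"
        using xy 1[of x] 1[of y] 2 unfolding lm_c_def by (smt (verit))
    qed
  qed
  ultimately show ?thesis by simp
qed

lemma group_Lodha_Moore_G0: "group Lodha_Moore_G0"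
  by (simp add: Lodha_Moore_G0_def group.group_subgroup_generated group_Homeo_plus_R)

lemma carrier_Lodha_Moore_G0:
  "carrier Lodha_Moore_G0 = generate Homeo_plus_R {lm_a, lm_b, lm_c}"
  using lm_generators_in_Homeo_plus_R
  by (simp add: Lodha_Moore_G0_def carrier_subgroup_generated Int_absorb1)

lemma bounded_2cocycle_lincomb:
  assumes "\<omega> \<in> bounded_2cocycles G" "\<omega>' \<in> bounded_2cocycles G" "group G"
  shows "(\<lambda>p\<in>carrier G \<times> carrier G. r * \<omega> p + s * \<omega>' p) \<in> bounded_2cocycles G"
proof -
  interpret group G by fact
  have "bounded (\<omega> ` (carrier G \<times> carrier G))" "bounded (\<omega>' ` (carrier G \<times> carrier G))"
    using assms(1,2) by (simp_all add: bounded_2cocycles_def)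
  then obtain B B' where
    "\<forall>y\<in>\<omega> ` (carrier G \<times> carrier G). norm y \<le> B"
    "\<forall>y\<in>\<omega>' ` (carrier G \<times> carrier G). norm y \<le> B'"
    unfolding bounded_iff by blast
  then have B: "\<bar>\<omega> p\<bar> \<le> B" "\<bar>\<omega>' p\<bar> \<le> B'" if "p \<in> carrier G \<times> carrier G" for p
    using that by auto
  have "\<bar>r * \<omega> p + s * \<omega>' p\<bar> \<le> \<bar>r\<bar> * B + \<bar>s\<bar> * B'" if "p \<in> carrier G \<times> carrier G" for p
  proof -
    have "\<bar>r * \<omega> p + s * \<omega>' p\<bar> \<le> \<bar>r\<bar> * \<bar>\<omega> p\<bar> + \<bar>s\<bar> * \<bar>\<omega>' p\<bar>"
      by (rule order_trans[OF abs_triangle_ineq]) (simp add: abs_mult)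
    also have "\<dots> \<le> \<bar>r\<bar> * B + \<bar>s\<bar> * B'"
      using B that by (intro add_mono mult_left_mono) auto
    finally show ?thesis .
  qed
  then have "bounded ((\<lambda>p\<in>carrier G \<times> carrier G. r * \<omega> p + s * \<omega>' p) ` (carrier G \<times> carrier G))"
    unfolding bounded_iff by (intro exI[of _ "\<bar>r\<bar> * B + \<bar>s\<bar> * B'"]) auto
  moreover have "r * \<omega> (g2, g3) + s * \<omega>' (g2, g3)
      - (r * \<omega> (g1 \<otimes>\<^bsub>G\<^esub> g2, g3) + s * \<omega>' (g1 \<otimes>\<^bsub>G\<^esub> g2, g3))
      + (r * \<omega> (g1, g2 \<otimes>\<^bsub>G\<^esub> g3) + s * \<omega>' (g1, g2 \<otimes>\<^bsub>G\<^esub> g3))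
      - (r * \<omega> (g1, g2) + s * \<omega>' (g1, g2)) = 0"
    if "g1 \<in> carrier G" "g2 \<in> carrier G" "g3 \<in> carrier G" for g1 g2 g3
  proof -
    have "\<omega> (g2, g3) - \<omega> (g1 \<otimes>\<^bsub>G\<^esub> g2, g3) + \<omega> (g1, g2 \<otimes>\<^bsub>G\<^esub> g3) - \<omega> (g1, g2) = 0"
         "\<omega>' (g2, g3) - \<omega>' (g1 \<otimes>\<^bsub>G\<^esub> g2, g3) + \<omega>' (g1, g2 \<otimes>\<^bsub>G\<^esub> g3) - \<omega>' (g1, g2) = 0"
      using assms that by (auto simp: bounded_2cocycles_def)
    then have "r * (\<omega> (g2, g3) - \<omega> (g1 \<otimes>\<^bsub>G\<^esub> g2, g3) + \<omega> (g1, g2 \<otimes>\<^bsub>G\<^esub> g3) - \<omega> (g1, g2))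
        + s * (\<omega>' (g2, g3) - \<omega>' (g1 \<otimes>\<^bsub>G\<^esub> g2, g3) + \<omega>' (g1, g2 \<otimes>\<^bsub>G\<^esub> g3) - \<omega>' (g1, g2)) = 0"
      by simp
    then show ?thesis by (simp add: algebra_simps)
  qed
  ultimately show ?thesis
    unfolding bounded_2cocycles_def
    by (intro CollectI conjI ballI restrict_PiE_iff[THEN iffD2]) simp_all
qed

lemma zero_in_bounded_2cocycles:
  assumes "group G"
  shows "(\<lambda>p\<in>carrier G \<times> carrier G. 0) \<in> bounded_2cocycles G"
proof -
  interpret group G by fact
  show ?thesis
    by (auto simp: bounded_2cocycles_def bounded_iff)
qed

lemma comm_group_bounded_2cocycle_group:
  assumes "group G"
  shows "comm_group (bounded_2cocycle_group G)"
proof (rule comm_groupI)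
  note defs = bounded_2cocycle_group_def
  fix x assume x: "x \<in> carrier (bounded_2cocycle_group G)"
  then have ext: "x \<in> extensional (carrier G \<times> carrier G)"
    by (auto simp: defs bounded_2cocycles_def PiE_def)
  show "\<one>\<^bsub>bounded_2cocycle_group G\<^esub> \<otimes>\<^bsub>bounded_2cocycle_group G\<^esub> x = x"
    using ext by (auto simp: defs fun_eq_iff restrict_def extensional_def)
  have "(\<lambda>p\<in>carrier G \<times> carrier G. -1 * x p + 0 * x p) \<in> carrier (bounded_2cocycle_group G)"
    using x bounded_2cocycle_lincomb[of x G x "-1" 0] assms by (simp add: defs)
  moreover have "(\<lambda>p\<in>carrier G \<times> carrier G. -1 * x p + 0 * x p) \<otimes>\<^bsub>bounded_2cocycle_group G\<^esub> x
      = \<one>\<^bsub>bounded_2cocycle_group G\<^esub>"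
    by (auto simp: defs fun_eq_iff restrict_def)
  ultimately show "\<exists>y\<in>carrier (bounded_2cocycle_group G).
      y \<otimes>\<^bsub>bounded_2cocycle_group G\<^esub> x = \<one>\<^bsub>bounded_2cocycle_group G\<^esub>"
    by blast
next
  fix x y assume "x \<in> carrier (bounded_2cocycle_group G)" "y \<in> carrier (bounded_2cocycle_group G)"
  then show "x \<otimes>\<^bsub>bounded_2cocycle_group G\<^esub> y \<in> carrier (bounded_2cocycle_group G)"
    using bounded_2cocycle_lincomb[of x G y 1 1] assms by (simp add: bounded_2cocycle_group_def)
next
  show "\<one>\<^bsub>bounded_2cocycle_group G\<^esub> \<in> carrier (bounded_2cocycle_group G)"
    using zero_in_bounded_2cocycles[OF assms] by (simp add: bounded_2cocycle_group_def)
qed (auto simp: bounded_2cocycle_group_def fun_eq_iff restrict_def)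

lemma bounded_2coboundaries_subset:
  assumes "group G"
  shows "bounded_2coboundaries G \<subseteq> bounded_2cocycles G"
proof
  interpret group G by fact
  fix \<omega> assume "\<omega> \<in> bounded_2coboundaries G"
  then obtain \<phi> B where
    \<omega>: "\<omega> = (\<lambda>(g, h)\<in>carrier G \<times> carrier G. \<phi> g + \<phi> h - \<phi> (g \<otimes>\<^bsub>G\<^esub> h))"
    and B: "\<And>g. g \<in> carrier G \<Longrightarrow> \<bar>\<phi> g\<bar> \<le> B"
    by (auto simp: bounded_2coboundaries_def bounded_iff)
  have "\<bar>\<phi> g + \<phi> h - \<phi> (g \<otimes>\<^bsub>G\<^esub> h)\<bar> \<le> 3 * B" if "g \<in> carrier G" "h \<in> carrier G" for g h
    using B[of g] B[of h] B[of "g \<otimes>\<^bsub>G\<^esub> h"] that by (simp add: abs_le_iff)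
  then have "bounded (\<omega> ` (carrier G \<times> carrier G))"
    unfolding bounded_iff \<omega> by (intro exI[of _ "3 * B"]) auto
  then show "\<omega> \<in> bounded_2cocycles G"
    by (auto simp: bounded_2cocycles_def \<omega> m_assoc)
qed

lemma subgroup_bounded_2coboundaries:
  assumes "group G"
  shows "subgroup (bounded_2coboundaries G) (bounded_2cocycle_group G)"
proof -
  interpret group G by fact
  interpret Z: comm_group "bounded_2cocycle_group G"
    by (rule comm_group_bounded_2cocycle_group) fact
  let ?d = "\<lambda>\<phi> :: 'a \<Rightarrow> real. \<lambda>(g, h)\<in>carrier G \<times> carrier G. \<phi> g + \<phi> h - \<phi> (g \<otimes>\<^bsub>G\<^esub> h)"
  have mem: "?d \<phi> \<in> bounded_2coboundaries G" if "bounded (\<phi> ` carrier G)" for \<phi>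
    using that by (auto simp: bounded_2coboundaries_def)
  have sub: "bounded_2coboundaries G \<subseteq> carrier (bounded_2cocycle_group G)"
    using bounded_2coboundaries_subset[OF assms] by (simp add: bounded_2cocycle_group_def)
  have add: "x \<otimes>\<^bsub>bounded_2cocycle_group G\<^esub> y \<in> bounded_2coboundaries G"
    if xy: "x \<in> bounded_2coboundaries G" "y \<in> bounded_2coboundaries G" for x y
  proof -
    obtain \<phi> \<psi> where "x = ?d \<phi>" "y = ?d \<psi>" and b: "bounded (\<phi> ` carrier G)" "bounded (\<psi> ` carrier G)"
      using xy by (auto simp: bounded_2coboundaries_def)
    then have "x \<otimes>\<^bsub>bounded_2cocycle_group G\<^esub> y = ?d (\<lambda>g. \<phi> g + \<psi> g)"
      by (auto simp: bounded_2cocycle_group_def fun_eq_iff restrict_def)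
    then show ?thesis
      using mem[OF bounded_plus_comp[OF b]] by simp
  qed
  have inv: "inv\<^bsub>bounded_2cocycle_group G\<^esub> x \<in> bounded_2coboundaries G"
    if x: "x \<in> bounded_2coboundaries G" for x
  proof -
    obtain \<phi> where \<phi>: "x = ?d \<phi>" and b: "bounded (\<phi> ` carrier G)"
      using x by (auto simp: bounded_2coboundaries_def)
    have n: "?d (\<lambda>g. - \<phi> g) \<in> bounded_2coboundaries G"
      by (rule mem) (use b in \<open>simp add: bounded_iff\<close>)
    moreover have "?d (\<lambda>g. - \<phi> g) \<otimes>\<^bsub>bounded_2cocycle_group G\<^esub> x = \<one>\<^bsub>bounded_2cocycle_group G\<^esub>"
      by (auto simp: \<phi> bounded_2cocycle_group_def fun_eq_iff restrict_def)
    ultimately show ?thesis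
      using Z.inv_equality[of "?d (\<lambda>g. - \<phi> g)" x] subsetD[OF sub x] subsetD[OF sub n] by simp
  qed
  show ?thesis
  proof (rule Z.subgroupI)
    show "bounded_2coboundaries G \<noteq> {}"
      using mem[of "\<lambda>_. 0"] by (auto simp: bounded_iff)
  qed (use sub add inv in blast)+
qed

lemma comm_group_second_bounded_cohomology:
  assumes "group G"
  shows "comm_group (second_bounded_cohomology G)"
  unfolding second_bounded_cohomology_def
  using assms
  by (intro comm_group.abelian_FactGroup comm_group_bounded_2cocycle_group
      subgroup_bounded_2coboundaries)

end

(* The class of a bounded cocycle defines a central extension E of H by the reals; homogenizing the
   projection to the reals yields a homogeneous quasimorphism phi on E, and the class vanishes as soon
   as phi is additive. Let N be a normal subgroup over which phi is already additive. Then phi descends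
   to the quotient of E by the kernel of this restriction, so phi is additive on any subgroup whose
   commutators lie in N. Likewise, if x, y and their conjugates x', y' by some g commute modulo N, then
   the defect of phi at (x x', y y') is twice its defect at (x, y); being bounded, it vanishes.
   For a group H of piecewise projective homeomorphisms, the germs at the two ends of the line and at
   the points fixed by H are affine in a suitable chart. Hence H has normal subgroups N1 and N2, with
   [H, H] in N1 and [N1, N1] in N2, such that the elements of N2 have trivial germs at all these ends.
   An element of N2 has compact support in each complementary component of the fixed points and is
   supported in finitely many of them. Any compact subset of one component is displaced by an element
   of H, so additivity over N2 follows by induction on the number of components. *)

theory Submission
  imports Defs
begin

section \<open>Homogeneous quasimorphisms\<close>

lemma zero_if_multiples_bounded:
  fixes a C :: real
  assumes "\<And>n::nat. real n * \<bar>a\<bar> \<le> C"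
  shows "a = 0"
proof (rule ccontr)
  assume "a \<noteq> 0"
  then obtain n :: nat where "C < real n * \<bar>a\<bar>"
    using reals_Archimedean3[of "\<bar>a\<bar>"] by auto
  then show False
    using assms[of n] by simp
qed

locale homogeneous_quasimorphism = group G for G (structure) +
  fixes \<phi> :: "'a \<Rightarrow> real" and D :: real
  assumes defect: "\<lbrakk>x \<in> carrier G; y \<in> carrier G\<rbrakk> \<Longrightarrow> \<bar>\<phi> (x \<otimes> y) - \<phi> x - \<phi> y\<bar> \<le> D"
    and pow: "x \<in> carrier G \<Longrightarrow> \<phi> (x [^] n) = real n * \<phi> x"
begin

definition additive_on :: "'a set \<Rightarrow> bool" where
  "additive_on K \<longleftrightarrow> (\<forall>x\<in>K. \<forall>y\<in>K. \<phi> (x \<otimes> y) = \<phi> x + \<phi> y)"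

lemma one: "\<phi> \<one> = 0"
  using pow[of \<one> 0] by simp

text \<open>Homogeneity turns an error \<open>C\<close> at every power into an error
  \<open>C / n\<close> at \<open>x\<close>. Identities for \<open>\<phi>\<close> can therefore be
  checked on powers, up to a bounded error.\<close>

lemma eq_if_powers_close:
  assumes "x \<in> carrier G" and "\<And>n::nat. \<bar>\<phi> (x [^] n) - real n * r\<bar> \<le> C"
  shows "\<phi> x = r"
proof -
  have "real n * \<bar>\<phi> x - r\<bar> \<le> C" for n
    using assms(2)[of n] pow[OF assms(1), of n]
    by (simp add: abs_mult flip: right_diff_distrib)
  then show ?thesis
    using zero_if_multiples_bounded[of "\<phi> x - r" C] by simp
qed

text \<open>Since \<open>(x \<otimes> y) [^] n\<close> equals
  \<open>x [^] n \<otimes> y [^] n\<close>, the error at each power is a single defect.\<close>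

lemma commuting:
  assumes "x \<in> carrier G" "y \<in> carrier G" "x \<otimes> y = y \<otimes> x"
  shows "\<phi> (x \<otimes> y) = \<phi> x + \<phi> y"
proof (rule eq_if_powers_close)
  fix n :: nat
  have "\<bar>\<phi> (x [^] n \<otimes> y [^] n) - \<phi> (x [^] n) - \<phi> (y [^] n)\<bar> \<le> D"
    using assms(1,2) by (intro defect) auto
  then show "\<bar>\<phi> ((x \<otimes> y) [^] n) - real n * (\<phi> x + \<phi> y)\<bar> \<le> D"
    unfolding pow_mult_distrib[OF assms(3,1,2)] using assms(1,2) by (simp add: pow algebra_simps)
qed (use assms(1,2) in auto)

lemma inverse:
  assumes "x \<in> carrier G"
  shows "\<phi> (inv x) = - \<phi> x"
  using commuting[of x "inv x"] assms by (simp add: one)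

text \<open>Conjugation passes to powers. Splitting off \<open>g\<close> and \<open>inv g\<close>
  costs two defects for every \<open>n\<close>, and the values at \<open>g\<close> and
  \<open>inv g\<close> cancel.\<close>

lemma conjugation_invariant:
  assumes "x \<in> carrier G" "g \<in> carrier G"
  shows "\<phi> (g \<otimes> x \<otimes> inv g) = \<phi> x"
proof (rule eq_if_powers_close)
  fix n :: nat
  have "(g \<otimes> x \<otimes> inv g) [^] n = g \<otimes> x [^] n \<otimes> inv g"
  proof (induction n)
    case (Suc n)
    have "(g \<otimes> x \<otimes> inv g) [^] Suc n = g \<otimes> x [^] n \<otimes> (inv g \<otimes> g) \<otimes> x \<otimes> inv g"
      unfolding nat_pow_Suc Suc.IH
      using assms by (simp only: m_assoc m_closed inv_closed nat_pow_closed)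
    then show ?case
      using assms by (simp add: m_assoc)
  qed (use assms in simp)
  moreover have "\<bar>\<phi> (g \<otimes> x [^] n \<otimes> inv g) - \<phi> (g \<otimes> x [^] n) - \<phi> (inv g)\<bar> \<le> D"
    "\<bar>\<phi> (g \<otimes> x [^] n) - \<phi> g - \<phi> (x [^] n)\<bar> \<le> D"
    using assms by (auto intro: defect)
  ultimately show "\<bar>\<phi> ((g \<otimes> x \<otimes> inv g) [^] n) - real n * \<phi> x\<bar> \<le> 2 * D"
    using assms by (simp add: pow inverse)
qed (use assms in auto)

section \<open>Quasimorphisms that are additive over a normal subgroup\<close>

context
  fixes N
  assumes N: "N \<lhd> G" and additive: "additive_on N"
begin

lemma N_closed: "n \<in> N \<Longrightarrow> n \<in> carrier G"
  by (rule subgroup.mem_carrier[OF normal_imp_subgroup[OF N]])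

text \<open>This is the kernel of the homomorphism that \<open>\<phi>\<close> restricts to on
  \<open>N\<close>; conjugation invariance makes it normal in the whole group.\<close>

lemma zeros_normal: "{n \<in> N. \<phi> n = 0} \<lhd> G"
proof -
  interpret N: normal N G by (rule N)
  show ?thesis
  proof (intro normal_invI subgroupI)
    show "{n \<in> N. \<phi> n = 0} \<noteq> {}"
      using N.one_closed one by blast
  qed (use additive in \<open>auto simp: additive_on_def inverse conjugation_invariant N.inv_op_closed2\<close>)
qed

interpretation L: normal "{n \<in> N. \<phi> n = 0}" G
  by (rule zeros_normal)

abbreviation proj :: "'a \<Rightarrow> 'a set" where
  "proj x \<equiv> {n \<in> N. \<phi> n = 0} #> x"

text \<open>Modulo the kernel, \<open>n \<otimes> x\<close> and \<open>x\<close> have equal powers.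
  The powers themselves differ by a factor \<open>l\<close> from the kernel, so the error is the
  defect at \<open>l\<close> and \<open>x [^] k\<close>.\<close>

lemma zeros_mult:
  assumes "n \<in> N" "\<phi> n = 0" "x \<in> carrier G"
  shows "\<phi> (n \<otimes> x) = \<phi> x"
proof (rule eq_if_powers_close)
  fix k :: nat
  have n: "n \<in> carrier G" "n \<otimes> x \<in> carrier G"
    using assms N_closed by auto
  have "proj (n \<otimes> x) = proj x"
    using assms by (intro repr_independence[symmetric] rcosI L.subgroup_axioms) (auto dest: N_closed)
  then have "proj ((n \<otimes> x) [^] k) = proj (x [^] k)"
    using L.FactGroup_pow[of "n \<otimes> x" k] L.FactGroup_pow[of x k] n assms(3) by simp
  then have "(n \<otimes> x) [^] k \<in> proj (x [^] k)"
    using rcos_self[OF nat_pow_closed[OF n(2)] L.subgroup_axioms, of k] by simp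
  then obtain l where l: "l \<in> N" "\<phi> l = 0" "(n \<otimes> x) [^] k = l \<otimes> x [^] k"
    by (auto simp: r_coset_def)
  then show "\<bar>\<phi> ((n \<otimes> x) [^] k) - real k * \<phi> x\<bar> \<le> D"
    using defect[of l "x [^] k"] assms by (simp add: pow N_closed)
qed (use assms N_closed in auto)

lemma descends:
  assumes "x \<in> carrier G" "y \<in> carrier G" "proj x = proj y"
  shows "\<phi> x = \<phi> y"
proof -
  have "x \<in> proj y"
    using assms rcos_self L.subgroup_axioms by blast
  then show ?thesis
    using assms by (auto simp: r_coset_def zeros_mult)
qed

lemma proj_mult: "\<lbrakk>x \<in> carrier G; y \<in> carrier G\<rbrakk> \<Longrightarrow> proj (x \<otimes> y) = proj x <#> proj y"
  by (simp add: L.rcos_sum)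

text \<open>The argument of \<open>commuting\<close>, with the power law taken in the quotient and
  brought back by \<open>descends\<close>.\<close>

lemma additive_if_proj_commute:
  assumes "x \<in> carrier G" "y \<in> carrier G" "proj (x \<otimes> y) = proj (y \<otimes> x)"
  shows "\<phi> (x \<otimes> y) = \<phi> x + \<phi> y"
proof (rule eq_if_powers_close)
  fix k :: nat
  interpret Q: group "G Mod {n \<in> N. \<phi> n = 0}"
    by (rule L.factorgroup_is_group)
  have "(proj x <#> proj y) [^]\<^bsub>G Mod {n \<in> N. \<phi> n = 0}\<^esub> k
      = proj x [^]\<^bsub>G Mod {n \<in> N. \<phi> n = 0}\<^esub> k <#> proj y [^]\<^bsub>G Mod {n \<in> N. \<phi> n = 0}\<^esub> k"
    using Q.pow_mult_distrib[of "proj x" "proj y" k] assms(3)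
    by (simp add: proj_mult[OF assms(1,2)] proj_mult[OF assms(2,1)] carrier_FactGroup assms(1,2)
        del: L.rcos_sum)
  then have "proj ((x \<otimes> y) [^] k) = proj (x [^] k \<otimes> y [^] k)"
    using assms(1,2) by (simp only: proj_mult L.FactGroup_pow nat_pow_closed m_closed flip: proj_mult)
  then have "\<phi> ((x \<otimes> y) [^] k) = \<phi> (x [^] k \<otimes> y [^] k)"
    using assms(1,2) by (intro descends) auto
  then show "\<bar>\<phi> ((x \<otimes> y) [^] k) - real k * (\<phi> x + \<phi> y)\<bar> \<le> D"
    using defect[of "x [^] k" "y [^] k"] assms(1,2) by (simp add: pow algebra_simps)
qed (use assms(1,2) in auto)

text \<open>The commutator \<open>?l\<close> is a conjugate of \<open>n\<close> times
  \<open>inv n\<close>. It lies in \<open>N\<close>, and additivity there gives it the value 0, so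
  \<open>x\<close> and \<open>n\<close> commute in the quotient.\<close>

lemma normal_mult:
  assumes "n \<in> N" "x \<in> carrier G"
  shows "\<phi> (x \<otimes> n) = \<phi> x + \<phi> n"
proof (rule additive_if_proj_commute)
  interpret N: normal N G by (rule N)
  let ?l = "x \<otimes> n \<otimes> inv x \<otimes> inv n"
  have n: "n \<in> carrier G" using assms N_closed by simp
  have "\<phi> ?l = 0"
    using assms additive n by (simp add: additive_on_def N.inv_op_closed2 conjugation_invariant inverse)
  moreover have "?l \<in> N"
    using assms by (simp add: N.inv_op_closed2)
  moreover have "x \<otimes> n = ?l \<otimes> (n \<otimes> x)"
    using assms n by (simp add: m_assoc) (simp add: inv_solve_left flip: m_assoc)
  ultimately show "proj (x \<otimes> n) = proj (n \<otimes> x)"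
    using assms n by (intro repr_independence[symmetric] L.subgroup_axioms) (auto simp: r_coset_def)
qed (use assms N_closed in auto)

text \<open>A commutator in \<open>N\<close> lies in the kernel: \<open>x \<otimes> ?n\<close> is a
  conjugate of \<open>x\<close>, so \<open>\<phi>\<close> agrees at both, and
  \<open>normal_mult\<close> leaves \<open>\<phi> ?n = 0\<close>.\<close>

lemma proj_commute:
  assumes "x \<in> carrier G" "y \<in> carrier G" "inv (y \<otimes> x) \<otimes> (x \<otimes> y) \<in> N"
  shows "proj (x \<otimes> y) = proj (y \<otimes> x)"
proof -
  interpret Q: group "G Mod {n \<in> N. \<phi> n = 0}"
    by (rule L.factorgroup_is_group)
  let ?n = "inv (y \<otimes> x) \<otimes> (x \<otimes> y)"
  have n: "x \<otimes> y = y \<otimes> x \<otimes> ?n" "inv y \<otimes> x \<otimes> inv (inv y) = x \<otimes> ?n"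
    using assms(1,2) by (simp_all add: inv_mult_group m_assoc) (simp_all flip: m_assoc)
  then have "\<phi> (x \<otimes> ?n) = \<phi> x"
    using conjugation_invariant[of x "inv y"] assms(1,2) by simp
  then have "\<phi> ?n = 0"
    using normal_mult assms by simp
  have "proj ?n = {n \<in> N. \<phi> n = 0}"
    using assms \<open>\<phi> ?n = 0\<close> by (intro coset_join2 L.subgroup_axioms) auto
  then have "proj (y \<otimes> x \<otimes> ?n) = proj (y \<otimes> x)"
    using Q.r_one[of "proj (y \<otimes> x)"] proj_mult[of "y \<otimes> x" ?n] assms(1,2)
    by (simp add: carrier_FactGroup)
  then show ?thesis
    by (simp flip: n)
qed

lemma additive_if_commutators_in_normal:
  assumes "K \<subseteq> carrier G" "\<And>x y. \<lbrakk>x \<in> K; y \<in> K\<rbrakk> \<Longrightarrow> inv (y \<otimes> x) \<otimes> (x \<otimes> y) \<in> N"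
  shows "additive_on K"
  unfolding additive_on_def using assms
  by (intro ballI additive_if_proj_commute proj_commute) auto

text \<open>If \<open>x\<close>, \<open>y\<close> commute with their conjugates \<open>x'\<close>, \<open>y'\<close>, then the defect of \<open>\<phi>\<close> at
  \<open>(x x', y y')\<close> is twice the defect at \<open>(x, y)\<close>; iterating this, the defect vanishes since it is
  bounded.\<close>

lemma additive_if_displaceable:
  assumes M: "M \<lhd> G"
    and displace: "\<And>x y. \<lbrakk>x \<in> M; y \<in> M\<rbrakk> \<Longrightarrow> \<exists>g\<in>carrier G. \<forall>u\<in>{x, y, x \<otimes> y}. \<forall>v\<in>{x, y, x \<otimes> y}.
      inv (g \<otimes> v \<otimes> inv g \<otimes> u) \<otimes> (u \<otimes> (g \<otimes> v \<otimes> inv g)) \<in> N"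
  shows "additive_on M"
  unfolding additive_on_def
proof (intro ballI)
  interpret M: normal M G by (rule M)
  let ?\<delta> = "\<lambda>x y. \<phi> (x \<otimes> y) - \<phi> x - \<phi> y"
  have double: "\<exists>x'\<in>M. \<exists>y'\<in>M. ?\<delta> x' y' = 2 * ?\<delta> x y" if xy: "x \<in> M" "y \<in> M" for x y
  proof -
    obtain g where g: "g \<in> carrier G"
      and comm: "\<And>u v. \<lbrakk>u \<in> {x, y, x \<otimes> y}; v \<in> {x, y, x \<otimes> y}\<rbrakk> \<Longrightarrow>
        inv (g \<otimes> v \<otimes> inv g \<otimes> u) \<otimes> (u \<otimes> (g \<otimes> v \<otimes> inv g)) \<in> N"
      using displace[OF xy] by blast
    define c where "c v = g \<otimes> v \<otimes> inv g" for v
    have xyG: "x \<in> carrier G" "y \<in> carrier G"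
      using xy by auto
    have cM: "c v \<in> M" "c v \<in> carrier G" "\<phi> (c v) = \<phi> v" if "v \<in> M" for v
      using that g by (auto simp: c_def M.inv_op_closed2 conjugation_invariant)
    have cG: "c x \<in> carrier G" "c y \<in> carrier G"
      using cM xy by auto
    have pc: "proj (u \<otimes> c v) = proj (c v \<otimes> u)" if "u \<in> {x, y, x \<otimes> y}" "v \<in> {x, y, x \<otimes> y}" for u v
      using that comm xy cM by (intro proj_commute) (auto simp: c_def[symmetric])
    \<comment> \<open>Taken at \<open>x\<close>, \<open>y\<close> and \<open>x \<otimes> y\<close>,
      this doubles all three terms of the defect.\<close>
    have add: "\<phi> (u \<otimes> c u) = 2 * \<phi> u" if "u \<in> {x, y, x \<otimes> y}" for u
    proof -
      have "u \<in> M" using that xy by auto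
      then show ?thesis
        using additive_if_proj_commute[of u "c u"] pc[OF that that] cM[of u] M.mem_carrier by simp
    qed
    have "c (x \<otimes> y) = g \<otimes> x \<otimes> (inv g \<otimes> g) \<otimes> y \<otimes> inv g"
      using g xyG by (simp add: c_def m_assoc)
    also have "\<dots> = c x \<otimes> c y"
      using g xyG by (simp only: c_def m_assoc m_closed inv_closed)
    finally have cxy: "c (x \<otimes> y) = c x \<otimes> c y" .
    \<comment> \<open>Only the inner factors \<open>c x\<close> and \<open>y\<close> have to change
      places, which \<open>pc\<close> permits in the quotient.\<close>
    have "proj (x \<otimes> c x \<otimes> (y \<otimes> c y)) = proj (x \<otimes> (c x \<otimes> y) \<otimes> c y)"
      using xyG cG by (simp add: m_assoc)
    also have "\<dots> = proj x <#> proj (c x \<otimes> y) <#> proj (c y)"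
      using xyG cG by (simp only: proj_mult m_closed)
    also have "\<dots> = proj x <#> proj (y \<otimes> c x) <#> proj (c y)"
      by (simp add: pc)
    also have "\<dots> = proj (x \<otimes> (y \<otimes> c x) \<otimes> c y)"
      using xyG cG by (simp only: proj_mult m_closed)
    also have "\<dots> = proj (x \<otimes> y \<otimes> c (x \<otimes> y))"
      using xyG cG by (simp add: m_assoc cxy)
    finally have "\<phi> (x \<otimes> c x \<otimes> (y \<otimes> c y)) = \<phi> (x \<otimes> y \<otimes> c (x \<otimes> y))"
      using xyG cG by (intro descends) (auto simp: cxy)
    then have "?\<delta> (x \<otimes> c x) (y \<otimes> c y) = 2 * ?\<delta> x y"
      by (simp add: add)
    moreover have "x \<otimes> c x \<in> M" "y \<otimes> c y \<in> M"
      using xy cM by auto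
    ultimately show ?thesis by blast
  qed
  have iterate: "2 ^ k * \<bar>?\<delta> x y\<bar> \<le> D" if "x \<in> M" "y \<in> M" for k x y
    using that
  proof (induction k arbitrary: x y)
    case 0
    then show ?case by (simp add: defect)
  next
    case (Suc k)
    then obtain x' y' where "x' \<in> M" "y' \<in> M" "?\<delta> x' y' = 2 * ?\<delta> x y"
      using double by meson
    moreover from this have "\<bar>?\<delta> x' y'\<bar> = 2 * \<bar>?\<delta> x y\<bar>"
      by (simp only: abs_mult abs_numeral)
    ultimately show ?case
      using Suc.IH[of x' y'] by simp
  qed
  fix x y assume xy: "x \<in> M" "y \<in> M"
  \<comment> \<open>Exponential growth is weakened to linear growth by
    \<open>k \<le> 2 ^ k\<close>.\<close>
  have "real k * \<bar>?\<delta> x y\<bar> \<le> D" for k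
  proof -
    have "real k * \<bar>?\<delta> x y\<bar> \<le> 2 ^ k * \<bar>?\<delta> x y\<bar>"
      by (intro mult_right_mono) (auto simp: of_nat_less_two_power less_imp_le)
    with iterate[OF xy, of k] show ?thesis by simp
  qed
  then have "?\<delta> x y = 0"
    by (rule zero_if_multiples_bounded)
  then show "\<phi> (x \<otimes> y) = \<phi> x + \<phi> y"
    by simp
qed

end

end

section \<open>The central extension of a bounded cocycle\<close>

text \<open>The value at \<open>x\<close> is the common point of the intervals \<open>[(p (x\<^sup>n) - D) / n, (p (x\<^sup>n) + D) / n]\<close>,
  which meet pairwise.\<close>

lemma (in group) homogenization:
  fixes p :: "'a \<Rightarrow> real"
  assumes defect: "\<And>x y. \<lbrakk>x \<in> carrier G; y \<in> carrier G\<rbrakk> \<Longrightarrow> \<bar>p (x \<otimes> y) - p x - p y\<bar> \<le> D"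
  obtains \<phi> where "homogeneous_quasimorphism G \<phi> (4 * D)"
    and "\<And>x n. x \<in> carrier G \<Longrightarrow> \<bar>p (x [^] (n::nat)) - real n * \<phi> x\<bar> \<le> D"
proof -
  \<comment> \<open>Splitting off one factor \<open>x [^] n\<close> at a time costs \<open>D\<close>
    at each of the \<open>m\<close> steps.\<close>
  have multiple: "\<bar>p (x [^] (Suc m * n)) - real (Suc m) * p (x [^] n)\<bar> \<le> real m * D"
    if x: "x \<in> carrier G" for x m and n :: nat
  proof (induction m)
    case (Suc m)
    have "x [^] (Suc (Suc m) * n) = x [^] n \<otimes> x [^] (Suc m * n)"
      using x by (simp add: nat_pow_mult)
    then have "\<bar>p (x [^] (Suc (Suc m) * n)) - p (x [^] n) - p (x [^] (Suc m * n))\<bar> \<le> D"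
      using defect[of "x [^] n" "x [^] (Suc m * n)"] x by simp
    with Suc show ?case
      by (simp add: algebra_simps abs_le_iff)
  qed simp
  have D: "0 \<le> D"
    using defect[of \<one> \<one>] by simp
  have "\<exists>r. \<forall>n. \<bar>p (x [^] n) - real n * r\<bar> \<le> D" if x: "x \<in> carrier G" for x
  proof -
    \<comment> \<open>The shift to \<open>Suc i\<close> keeps the denominators positive.\<close>
    let ?q = "\<lambda>i. p (x [^] Suc i)"
    let ?l = "\<lambda>i. (?q i - D) / real (Suc i)"
    have meet: "?l i \<le> (?q j + D) / real (Suc j)" for i j
    proof -
      \<comment> \<open>Both interval endpoints are compared with \<open>p\<close> at the common
        power.\<close>
      have "\<bar>p (x [^] (Suc i * Suc j)) - real (Suc i) * ?q j\<bar> \<le> real i * D"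
        "\<bar>p (x [^] (Suc i * Suc j)) - real (Suc j) * ?q i\<bar> \<le> real j * D"
        using multiple[OF x, of i "Suc j"] multiple[OF x, of j "Suc i"] by (simp_all only: mult.commute)
      then have "real (Suc j) * ?q i - real (Suc i) * ?q j \<le> real (Suc i) * D + real (Suc j) * D"
        using D by (simp add: abs_le_iff algebra_simps)
      then have "(?q i - D) * real (Suc j) \<le> (?q j + D) * real (Suc i)"
        by (simp add: algebra_simps)
      then show ?thesis
        by (simp add: frac_le_eq divide_le_eq pos_le_divide_eq pos_divide_le_eq)
    qed
    define r where "r = (SUP i. ?l i)"
    have "bdd_above (range ?l)"
      using meet[of _ 0] by (intro bdd_aboveI2)
    then have "?l i \<le> r" for i
      unfolding r_def by (intro cSUP_upper) auto
    moreover have "r \<le> (?q j + D) / real (Suc j)" for j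
      unfolding r_def by (intro cSUP_least) (use meet in auto)
    ultimately have "?q i - D \<le> r * real (Suc i)" "r * real (Suc i) \<le> ?q i + D" for i
      by (simp_all only: pos_divide_le_eq pos_le_divide_eq of_nat_0_less_iff zero_less_Suc)
    then have "\<bar>?q i - real (Suc i) * r\<bar> \<le> D" for i
      by (simp only: abs_le_iff) (simp add: algebra_simps)
    moreover have "\<bar>p (x [^] (0::nat)) - real 0 * r\<bar> \<le> D"
      using defect[of \<one> \<one>] by simp
    ultimately have "\<bar>p (x [^] n) - real n * r\<bar> \<le> D" for n
      by (cases n) blast+
    then show ?thesis by blast
  qed
  then obtain \<phi> where \<phi>: "\<And>x n. x \<in> carrier G \<Longrightarrow> \<bar>p (x [^] n) - real n * \<phi> x\<bar> \<le> D"
    by metis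
  have close: "\<bar>p x - \<phi> x\<bar> \<le> D" if "x \<in> carrier G" for x
    using \<phi>[OF that, of 1] that by simp
  have "homogeneous_quasimorphism G \<phi> (4 * D)"
  proof unfold_locales
    \<comment> \<open>One defect of \<open>p\<close>, and three replacements of \<open>p\<close> by
      \<open>\<phi>\<close> at a cost of \<open>D\<close> each.\<close>
    show "\<bar>\<phi> (x \<otimes> y) - \<phi> x - \<phi> y\<bar> \<le> 4 * D" if "x \<in> carrier G" "y \<in> carrier G" for x y
      using defect[OF that] close[OF that(1)] close[OF that(2)] close[OF m_closed[OF that]]
      by (simp add: abs_le_iff)
    show "\<phi> (x [^] n) = real n * \<phi> x" if x: "x \<in> carrier G" for x n
    proof -
      have "real k * \<bar>\<phi> (x [^] n) - real n * \<phi> x\<bar> \<le> 2 * D" for k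
      proof -
        \<comment> \<open>The power \<open>n * k\<close> of \<open>x\<close> is read both as the
          \<open>k\<close>-th power of \<open>x [^] n\<close> and as a power of
          \<open>x\<close>.\<close>
        have "\<bar>p (x [^] (n * k)) - real k * \<phi> (x [^] n)\<bar> \<le> D"
          "\<bar>p (x [^] (n * k)) - real k * (real n * \<phi> x)\<bar> \<le> D"
          using \<phi>[of "x [^] n" k] \<phi>[of x "n * k"] x by (simp_all add: nat_pow_pow mult_ac)
        then have "\<bar>real k * \<phi> (x [^] n) - real k * (real n * \<phi> x)\<bar> \<le> 2 * D"
          by (simp add: abs_le_iff)
        then show ?thesis
          by (simp add: abs_mult flip: right_diff_distrib)
      qed
      then have "\<phi> (x [^] n) - real n * \<phi> x = 0"
        by (rule zero_if_multiples_bounded)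
      then show ?thesis by simp
    qed
  qed
  then show ?thesis
    using \<phi> that by blast
qed

section \<open>The extension of \<open>G\<close> by the reals given by a cocycle\<close>

definition central_extension ::
    "('a, 'b) monoid_scheme \<Rightarrow> ('a \<times> 'a \<Rightarrow> real) \<Rightarrow> ('a \<times> real) monoid" where
  "central_extension G \<omega> =
    \<lparr>carrier = carrier G \<times> UNIV,
     monoid.mult = (\<lambda>(g, s) (h, t). (g \<otimes>\<^bsub>G\<^esub> h, s + t + \<omega> (g, h))),
     one = (\<one>\<^bsub>G\<^esub>, - \<omega> (\<one>\<^bsub>G\<^esub>, \<one>\<^bsub>G\<^esub>))\<rparr>"

locale bounded_cocycle = group G for G (structure) +
  fixes \<omega> :: "'a \<times> 'a \<Rightarrow> real"
  assumes bounded_cocycle: "\<omega> \<in> bounded_2cocycles G"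
begin

abbreviation E where "E \<equiv> central_extension G \<omega>"

lemma cocycle:
  "\<lbrakk>g1 \<in> carrier G; g2 \<in> carrier G; g3 \<in> carrier G\<rbrakk>
    \<Longrightarrow> \<omega> (g1, g2) + \<omega> (g1 \<otimes> g2, g3) = \<omega> (g2, g3) + \<omega> (g1, g2 \<otimes> g3)"
  using bounded_cocycle by (fastforce simp: bounded_2cocycles_def)

text \<open>The cocycle is not assumed normalized; its value at the unit pair is constant along both
  axes and explains the second coordinate of the unit of \<open>E\<close>.\<close>

lemma cocycle_one:
  assumes "g \<in> carrier G"
  shows "\<omega> (\<one>, g) = \<omega> (\<one>, \<one>)" "\<omega> (g, \<one>) = \<omega> (\<one>, \<one>)"
  using cocycle[of \<one> \<one> g] cocycle[of g \<one> \<one>] assms by simp_all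

lemma E_simps [simp]:
  "carrier E = carrier G \<times> UNIV"
  "(g, s) \<otimes>\<^bsub>E\<^esub> (h, t) = (g \<otimes> h, s + t + \<omega> (g, h))"
  "\<one>\<^bsub>E\<^esub> = (\<one>, - \<omega> (\<one>, \<one>))"
  by (simp_all add: central_extension_def)

lemma group_E: "group E"
proof (rule groupI)
  fix x assume "x \<in> carrier E"
  then obtain g s where x: "x = (g, s)" and g: "g \<in> carrier G" by auto
  then show "\<one>\<^bsub>E\<^esub> \<otimes>\<^bsub>E\<^esub> x = x"
    by (simp add: g cocycle_one[OF g])
  have "(inv g, - s - \<omega> (inv g, g) - \<omega> (\<one>, \<one>)) \<otimes>\<^bsub>E\<^esub> x = \<one>\<^bsub>E\<^esub>"
    using x g by simp
  then show "\<exists>y\<in>carrier E. y \<otimes>\<^bsub>E\<^esub> x = \<one>\<^bsub>E\<^esub>"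
    using g by (intro bexI) auto
next
  fix x y z assume "x \<in> carrier E" "y \<in> carrier E" "z \<in> carrier E"
  then show "x \<otimes>\<^bsub>E\<^esub> y \<otimes>\<^bsub>E\<^esub> z = x \<otimes>\<^bsub>E\<^esub> (y \<otimes>\<^bsub>E\<^esub> z)"
    by (auto simp: m_assoc cocycle)
qed auto

lemma fst_hom: "group_hom E G fst"
  using group_E by (auto simp: group_hom_def group_hom_axioms_def hom_def)

text \<open>\<open>N \<times> UNIV\<close> is the preimage of \<open>N\<close> under
  \<open>fst\<close>, so every closure property is read off the first coordinates.\<close>

lemma normal_lift:
  assumes "N \<lhd> G"
  shows "N \<times> UNIV \<lhd> E"
proof -
  interpret E: group E by (rule group_E)
  interpret fst: group_hom E G fst by (rule fst_hom)
  interpret N: normal N G by fact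
  have inv: "fst (inv\<^bsub>E\<^esub> x) = inv (fst x)" if "fst x \<in> carrier G" for x
    using that by (intro fst.hom_inv) (simp add: mem_Times_iff)
  have mem: "x \<in> N \<times> UNIV \<longleftrightarrow> fst x \<in> N" for x :: "'a \<times> real"
    by (simp add: mem_Times_iff)
  have mult: "fst (x \<otimes>\<^bsub>E\<^esub> y) = fst x \<otimes> fst y" for x y
    by (cases x; cases y) simp
  show ?thesis
  proof (intro E.normal_invI E.subgroupI)
    show "N \<times> (UNIV :: real set) \<subseteq> carrier E"
      using N.subset by auto
    show "N \<times> (UNIV :: real set) \<noteq> {}"
      using N.one_closed by blast
    show "inv\<^bsub>E\<^esub> x \<in> N \<times> UNIV" if "x \<in> N \<times> UNIV" for x
      using that unfolding mem by (simp add: inv)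
    show "x \<otimes>\<^bsub>E\<^esub> y \<in> N \<times> UNIV" if "x \<in> N \<times> UNIV" "y \<in> N \<times> UNIV" for x y
      using that unfolding mem by (simp add: mult)
    show "x \<otimes>\<^bsub>E\<^esub> h \<otimes>\<^bsub>E\<^esub> inv\<^bsub>E\<^esub> x \<in> N \<times> UNIV" if "x \<in> carrier E" "h \<in> N \<times> UNIV" for x h
      using that unfolding mem by (auto simp: mult inv N.inv_op_closed2)
  qed
qed

end

text \<open>By \<open>translate\<close>, \<open>\<phi>\<close> has slope 1 along each fibre and is
  determined by its values at \<open>(g, 0)\<close>. These form the bounded function whose
  coboundary is to be \<open>\<omega>\<close>.\<close>

locale homogenized_cocycle = bounded_cocycle +
  fixes \<phi> :: "'a \<times> real \<Rightarrow> real" and D :: real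
  assumes quasimorphism: "homogeneous_quasimorphism E \<phi> D"
    and translate: "g \<in> carrier G \<Longrightarrow> \<phi> (g, s) = \<phi> (g, 0) + s"
    and bounded: "g \<in> carrier G \<Longrightarrow> \<bar>\<phi> (g, 0)\<bar> \<le> D"
begin

text \<open>For a subgroup \<open>K\<close> this says that \<open>\<phi>\<close> is a homomorphism
  on the preimage of \<open>K\<close>, which splits the extension there.\<close>

definition splits_over :: "'a set \<Rightarrow> bool" where
  "splits_over K \<longleftrightarrow> (\<forall>x\<in>K. \<forall>y\<in>K. \<phi> (x \<otimes> y, 0) + \<omega> (x, y) = \<phi> (x, 0) + \<phi> (y, 0))"

interpretation \<phi>: homogeneous_quasimorphism E \<phi> D
  by (rule quasimorphism)

interpretation fst: group_hom E G fst
  by (rule fst_hom)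

text \<open>By \<open>translate\<close> the central coordinates \<open>s\<close> and
  \<open>t\<close> cancel from both sides.\<close>

lemma splits_over_iff:
  assumes "K \<subseteq> carrier G"
  shows "splits_over K \<longleftrightarrow> \<phi>.additive_on (K \<times> UNIV)"
proof -
  have "\<phi> ((x, s) \<otimes>\<^bsub>E\<^esub> (y, t)) = \<phi> (x, s) + \<phi> (y, t)
      \<longleftrightarrow> \<phi> (x \<otimes> y, 0) + \<omega> (x, y) = \<phi> (x, 0) + \<phi> (y, 0)"
    if "x \<in> K" "y \<in> K" for x y s t
  proof -
    have "x \<in> carrier G" "y \<in> carrier G"
      using that assms by auto
    then show ?thesis
      using translate[of x s] translate[of y t] translate[of "x \<otimes> y" "s + t + \<omega> (x, y)"] by auto
  qed
  then show ?thesis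
    unfolding splits_over_def \<phi>.additive_on_def by (auto simp del: E_simps)
qed

lemma splits_over_one: "splits_over {\<one>}"
  using \<phi>.commuting[of "(\<one>, 0)" "(\<one>, 0)"] translate[of \<one> "\<omega> (\<one>, \<one>)"]
  by (simp add: splits_over_def)

lemma commutator_lift:
  assumes "x \<in> carrier E" "y \<in> carrier E"
    "inv (fst y \<otimes> fst x) \<otimes> (fst x \<otimes> fst y) \<in> N"
  shows "inv\<^bsub>E\<^esub> (y \<otimes>\<^bsub>E\<^esub> x) \<otimes>\<^bsub>E\<^esub> (x \<otimes>\<^bsub>E\<^esub> y) \<in> N \<times> UNIV"
  using assms by (simp add: mem_Times_iff fst.hom_mult fst.hom_inv \<phi>.inv_closed \<phi>.m_closed del: E_simps)

lemma splits_if_commutators_in_normal: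
  assumes "N \<lhd> G" "splits_over N" "K \<subseteq> carrier G"
    and "\<And>x y. \<lbrakk>x \<in> K; y \<in> K\<rbrakk> \<Longrightarrow> inv (y \<otimes> x) \<otimes> (x \<otimes> y) \<in> N"
  shows "splits_over K"
proof -
  have "N \<subseteq> carrier G"
    using assms(1) normal_imp_subgroup subgroup.subset by blast
  then have N: "\<phi>.additive_on (N \<times> UNIV)"
    using assms(2) splits_over_iff by blast
  have "\<phi>.additive_on (K \<times> UNIV)"
  proof (rule \<phi>.additive_if_commutators_in_normal[OF normal_lift[OF assms(1)] N])
    show sub: "K \<times> UNIV \<subseteq> carrier E"
      using assms(3) by auto
    fix x y assume xy: "x \<in> K \<times> (UNIV :: real set)" "y \<in> K \<times> (UNIV :: real set)"
    then show "inv\<^bsub>E\<^esub> (y \<otimes>\<^bsub>E\<^esub> x) \<otimes>\<^bsub>E\<^esub> (x \<otimes>\<^bsub>E\<^esub> y) \<in> N \<times> UNIV"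
      using sub by (intro commutator_lift assms(4)) (auto simp: mem_Times_iff simp del: E_simps)
  qed
  then show ?thesis
    using splits_over_iff assms(3) by blast
qed

lemma splits_if_displaceable:
  assumes "N \<lhd> G" "splits_over N" "M \<lhd> G"
    and displace: "\<And>x y. \<lbrakk>x \<in> M; y \<in> M\<rbrakk> \<Longrightarrow> \<exists>g\<in>carrier G. \<forall>u\<in>{x, y, x \<otimes> y}. \<forall>v\<in>{x, y, x \<otimes> y}.
      inv (g \<otimes> v \<otimes> inv g \<otimes> u) \<otimes> (u \<otimes> (g \<otimes> v \<otimes> inv g)) \<in> N"
  shows "splits_over M"
proof -
  have sub: "N \<subseteq> carrier G" "M \<subseteq> carrier G"
    using assms(1,3) normal_imp_subgroup subgroup.subset by blast+
  have N: "\<phi>.additive_on (N \<times> UNIV)"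
    using assms(2) splits_over_iff sub by blast
  have "\<phi>.additive_on (M \<times> UNIV)"
  proof (rule \<phi>.additive_if_displaceable[OF normal_lift[OF assms(1)] N normal_lift[OF assms(3)]])
    fix x y assume xy: "x \<in> M \<times> (UNIV :: real set)" "y \<in> M \<times> (UNIV :: real set)"
    then obtain g where g: "g \<in> carrier G"
      and comm: "\<And>u v. \<lbrakk>u \<in> {fst x, fst y, fst x \<otimes> fst y}; v \<in> {fst x, fst y, fst x \<otimes> fst y}\<rbrakk> \<Longrightarrow>
        inv (g \<otimes> v \<otimes> inv g \<otimes> u) \<otimes> (u \<otimes> (g \<otimes> v \<otimes> inv g)) \<in> N"
      using displace[of "fst x" "fst y"] by (auto simp: mem_Times_iff)
    \<comment> \<open>The conjugator is lifted to \<open>(g, 0)\<close>; any lift gives the same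
      first coordinates, and these decide membership in \<open>N \<times> UNIV\<close>.\<close>
    have E: "x \<in> carrier E" "y \<in> carrier E" "(g, 0) \<in> carrier E"
      using xy g sub by auto
    have "inv\<^bsub>E\<^esub> (c \<otimes>\<^bsub>E\<^esub> u) \<otimes>\<^bsub>E\<^esub> (u \<otimes>\<^bsub>E\<^esub> c) \<in> N \<times> UNIV"
      if "u \<in> {x, y, x \<otimes>\<^bsub>E\<^esub> y}" "v \<in> {x, y, x \<otimes>\<^bsub>E\<^esub> y}" "c = (g, 0) \<otimes>\<^bsub>E\<^esub> v \<otimes>\<^bsub>E\<^esub> inv\<^bsub>E\<^esub> (g, 0)" for u v c
    proof (rule commutator_lift)
      have uv: "u \<in> carrier E" "v \<in> carrier E"
        using that E \<phi>.m_closed by blast+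
      then show "u \<in> carrier E" "c \<in> carrier E"
        using that E \<phi>.m_closed \<phi>.inv_closed by blast+
      have "fst c = g \<otimes> fst v \<otimes> inv g"
        using fst.hom_inv[OF E(3)] unfolding that(3)
        by (simp add: fst.hom_mult uv E \<phi>.inv_closed \<phi>.m_closed del: E_simps)
      moreover have "fst u \<in> {fst x, fst y, fst x \<otimes> fst y}" "fst v \<in> {fst x, fst y, fst x \<otimes> fst y}"
        using that(1,2) fst.hom_mult[OF E(1,2)] by auto
      ultimately show "inv (fst c \<otimes> fst u) \<otimes> (fst u \<otimes> fst c) \<in> N"
        using comm by simp
    qed
    then show "\<exists>g\<in>carrier E. \<forall>u\<in>{x, y, x \<otimes>\<^bsub>E\<^esub> y}. \<forall>v\<in>{x, y, x \<otimes>\<^bsub>E\<^esub> y}.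
        inv\<^bsub>E\<^esub> (g \<otimes>\<^bsub>E\<^esub> v \<otimes>\<^bsub>E\<^esub> inv\<^bsub>E\<^esub> g \<otimes>\<^bsub>E\<^esub> u) \<otimes>\<^bsub>E\<^esub> (u \<otimes>\<^bsub>E\<^esub> (g \<otimes>\<^bsub>E\<^esub> v \<otimes>\<^bsub>E\<^esub> inv\<^bsub>E\<^esub> g)) \<in> N \<times> UNIV"
      using E(3) by blast
  qed
  then show ?thesis
    using splits_over_iff sub by blast
qed

lemma coboundary_if_splits:
  assumes "splits_over (carrier G)"
  shows "\<omega> \<in> bounded_2coboundaries G"
proof -
  have ext: "\<omega> \<in> extensional (carrier G \<times> carrier G)"
    using bounded_cocycle by (auto simp: bounded_2cocycles_def PiE_def)
  have "\<omega> = (\<lambda>(g, h)\<in>carrier G \<times> carrier G. \<phi> (g, 0) + \<phi> (h, 0) - \<phi> (g \<otimes> h, 0))"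
  proof (rule extensionalityI[OF ext])
    fix p assume "p \<in> carrier G \<times> carrier G"
    with assms show "\<omega> p = (\<lambda>(g, h)\<in>carrier G \<times> carrier G. \<phi> (g, 0) + \<phi> (h, 0) - \<phi> (g \<otimes> h, 0)) p"
      by (fastforce simp: splits_over_def)
  qed auto
  moreover have "Elementary_Metric_Spaces.bounded ((\<lambda>g. \<phi> (g, 0)) ` carrier G)"
    using bounded by (auto simp: bounded_iff intro!: exI[of _ D])
  ultimately show ?thesis
    unfolding bounded_2coboundaries_def by (intro CollectI exI[of _ "\<lambda>g. \<phi> (g, 0)"] conjI)
qed

end

text \<open>The projection \<open>snd\<close> is a quasimorphism on \<open>E\<close> whose defect is
  given by \<open>\<omega>\<close>; its homogenization serves as \<open>\<phi>\<close>.\<close>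

lemma (in bounded_cocycle) homogenized_cocycle_exists:
  obtains \<phi> D where "homogenized_cocycle G \<omega> \<phi> D"
proof -
  interpret E: group E by (rule group_E)
  have "bounded (\<omega> ` (carrier G \<times> carrier G))"
    using bounded_cocycle by (simp add: bounded_2cocycles_def)
  then obtain B where "\<forall>y\<in>\<omega> ` (carrier G \<times> carrier G). norm y \<le> B"
    unfolding bounded_iff by blast
  then have B: "\<bar>\<omega> (g, h)\<bar> \<le> B" if "g \<in> carrier G" "h \<in> carrier G" for g h
    using that by auto
  then have "\<bar>snd (x \<otimes>\<^bsub>E\<^esub> y) - snd x - snd y\<bar> \<le> B" if "x \<in> carrier E" "y \<in> carrier E" for x y
    using that by (cases x; cases y) auto
  then obtain \<phi> where \<phi>: "homogeneous_quasimorphism E \<phi> (4 * B)"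
    and close: "\<And>x n. x \<in> carrier E \<Longrightarrow> \<bar>snd (x [^]\<^bsub>E\<^esub> (n::nat)) - real n * \<phi> x\<bar> \<le> B"
    using E.homogenization by blast
  interpret \<phi>: homogeneous_quasimorphism E \<phi> "4 * B" by (rule \<phi>)
  let ?c = "\<omega> (\<one>, \<one>)"
  \<comment> \<open>Powers of \<open>(\<one>, s)\<close> are explicit. The shift by
    \<open>?c\<close> reflects that the unit of \<open>E\<close> has second coordinate
    \<open>- ?c\<close>.\<close>
  have central: "\<phi> (\<one>, s) = s + ?c" for s
  proof -
    have pow: "(\<one>, s) [^]\<^bsub>E\<^esub> n = (\<one>, real n * (s + ?c) - ?c)" for n :: nat
      by (induction n) (simp_all add: algebra_simps)
    have "real n * \<bar>\<phi> (\<one>, s) - (s + ?c)\<bar> \<le> 2 * B" for n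
    proof -
      have "\<bar>real n * (s + ?c) - ?c - real n * \<phi> (\<one>, s)\<bar> \<le> B"
        using close[of "(\<one>, s)" n] by (simp add: pow)
      moreover have "\<bar>?c\<bar> \<le> B"
        by (simp add: B)
      ultimately have "\<bar>real n * (\<phi> (\<one>, s) - (s + ?c))\<bar> \<le> 2 * B"
        by (simp only: right_diff_distrib abs_le_iff) linarith
      then show ?thesis
        by (simp add: abs_mult)
    qed
    then have "\<phi> (\<one>, s) - (s + ?c) = 0"
      by (rule zero_if_multiples_bounded)
    then show ?thesis by simp
  qed
  have "homogenized_cocycle G \<omega> \<phi> (4 * B)"
  proof unfold_locales
    fix g assume g: "g \<in> carrier G"
    show "\<phi> (g, s) = \<phi> (g, 0) + s" for s
    proof -
      \<comment> \<open>\<open>(g, s)\<close> is \<open>(g, 0)\<close> times a central element, and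
        \<open>\<phi>\<close> is additive on commuting pairs.\<close>
      have "\<phi> ((g, 0) \<otimes>\<^bsub>E\<^esub> (\<one>, s - ?c)) = \<phi> (g, 0) + \<phi> (\<one>, s - ?c)"
        using g by (intro \<phi>.commuting) (auto simp: cocycle_one[OF g])
      moreover have "(g, 0) \<otimes>\<^bsub>E\<^esub> (\<one>, s - ?c) = (g, s)"
        using g by (simp add: cocycle_one[OF g])
      ultimately show ?thesis
        by (simp only: central)
    qed
    \<comment> \<open>This is \<open>close\<close> for the exponent 1, as \<open>(g, 0)\<close> has
      second coordinate 0.\<close>
    have "\<bar>\<phi> (g, 0)\<bar> \<le> B"
      using close[of "(g, 0)" 1] E.nat_pow_Suc[of "(g, 0)" 0] g by (simp add: cocycle_one[OF g])
    then show "\<bar>\<phi> (g, 0)\<bar> \<le> 4 * B"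
      by linarith
  qed
  then show thesis by (rule that)
qed

lemma trivial_second_bounded_cohomologyI:
  assumes "group G" "bounded_2cocycles G \<subseteq> bounded_2coboundaries G"
  shows "trivial_group (second_bounded_cohomology G)"
proof -
  interpret Z: comm_group "bounded_2cocycle_group G"
    by (rule comm_group_bounded_2cocycle_group) fact
  interpret H: group "second_bounded_cohomology G"
    using comm_group_second_bounded_cohomology[OF assms(1)] by (rule comm_group.axioms)
  have "bounded_2cocycles G = bounded_2coboundaries G"
    using assms bounded_2coboundaries_subset by blast
  then have "carrier (bounded_2cocycle_group G) = bounded_2coboundaries G"
    by (simp add: bounded_2cocycle_group_def)
  then have "carrier (second_bounded_cohomology G) \<subseteq> {bounded_2coboundaries G}"
    unfolding second_bounded_cohomology_def carrier_FactGroup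
    using Z.coset_join2 subgroup_bounded_2coboundaries[OF assms(1)] by blast
  then show ?thesis
    unfolding H.trivial_group_subset by (simp add: second_bounded_cohomology_def)
qed

section \<open>Piecewise projective homeomorphisms\<close>

text \<open>\<open>u\<close> and \<open>v\<close> are the coordinates at source and target. The
  filter \<open>F\<close> treats one-sided germs and germs at infinity alike.\<close>

definition affine_germ ::
    "real filter \<Rightarrow> (real \<Rightarrow> real) \<Rightarrow> (real \<Rightarrow> real) \<Rightarrow> real \<Rightarrow> real \<Rightarrow> (real \<Rightarrow> real) \<Rightarrow> bool" where
  "affine_germ F u v \<alpha> \<beta> f \<longleftrightarrow> (\<forall>\<^sub>F t in F. v (f t) = \<alpha> * u t + \<beta>)"

lemma affine_germ_id: "affine_germ F u u 1 0 id"
  by (simp add: affine_germ_def)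

lemma affine_germ_comp:
  assumes "affine_germ F u v \<alpha> \<beta> f" "affine_germ F' v w \<alpha>' \<beta>' g" "filterlim f F' F"
  shows "affine_germ F u w (\<alpha>' * \<alpha>) (\<alpha>' * \<beta> + \<beta>') (g \<circ> f)"
proof -
  have "\<forall>\<^sub>F t in F. w (g (f t)) = \<alpha>' * v (f t) + \<beta>'"
    using eventually_compose_filterlim[OF _ assms(3)] assms(2) by (simp add: affine_germ_def)
  with assms(1) show ?thesis
    unfolding affine_germ_def by eventually_elim (simp add: algebra_simps)
qed

lemma affine_germ_inverse:
  assumes "affine_germ F u v \<alpha> \<beta> f" "\<alpha> \<noteq> 0" "filterlim g F F'" "\<And>s. f (g s) = s"
  shows "affine_germ F' v u (1 / \<alpha>) (- \<beta> / \<alpha>) g"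
proof -
  have "\<forall>\<^sub>F s in F'. v (f (g s)) = \<alpha> * u (g s) + \<beta>"
    using eventually_compose_filterlim[OF _ assms(3)] assms(1) by (simp add: affine_germ_def)
  then show ?thesis
    unfolding affine_germ_def by eventually_elim (use assms(2,4) in \<open>simp add: field_simps\<close>)
qed

text \<open>Via \<open>chart p\<close> a Moebius transformation becomes affine near \<open>p\<close>. At \<open>p\<close> itself \<open>chart p\<close> has the
  junk value \<open>0\<close>, which keeps it injective.\<close>

definition chart :: "real \<Rightarrow> real \<Rightarrow> real" where
  "chart p t = 1 / (t - p)"

lemma inj_chart: "inj (chart p)"
  by (rule injI) (simp add: chart_def)

text \<open>The difference \<open>f t - f p\<close> is the determinant times
  \<open>(t - p) / ((c t + d) (c p + d))\<close>. Expanding \<open>c t + d\<close> around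
  \<open>p\<close> makes its reciprocal affine in \<open>1 / (t - p)\<close>.\<close>

lemma moebius_affine_germ:
  assumes "c * p + d \<noteq> 0" "a * d - b * c \<noteq> 0" "f p = (a * p + b) / (c * p + d)" "F \<le> at p"
    and "\<forall>\<^sub>F t in F. f t = (a * t + b) / (c * t + d)"
  shows "affine_germ F (chart p) (chart (f p)) ((c * p + d)\<^sup>2 / (a * d - b * c))
    (c * (c * p + d) / (a * d - b * c)) f"
proof -
  have "((\<lambda>t. c * t + d) \<longlongrightarrow> c * p + d) (at p)"
    by (intro tendsto_intros)
  then have "\<forall>\<^sub>F t in at p. c * t + d \<noteq> 0"
    using assms(1) by (rule tendsto_imp_eventually_ne)
  moreover have "\<forall>\<^sub>F t in at p. t \<noteq> p"
    by (simp add: eventually_neq_at_within)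
  ultimately have "\<forall>\<^sub>F t in F. c * t + d \<noteq> 0 \<and> t \<noteq> p"
    using assms(4) by (auto simp: le_filter_def eventually_conj_iff)
  with assms(5) show ?thesis
    unfolding affine_germ_def
  proof eventually_elim
    case (elim t)
    let ?\<Delta> = "a * d - b * c"
    have "f t - f p = ?\<Delta> * (t - p) / ((c * t + d) * (c * p + d))"
    proof -
      have "f t - f p = ((a * t + b) * (c * p + d) - (a * p + b) * (c * t + d)) / ((c * t + d) * (c * p + d))"
        using elim assms(1,3) by (simp add: diff_frac_eq)
      also have "(a * t + b) * (c * p + d) - (a * p + b) * (c * t + d) = ?\<Delta> * (t - p)"
        by (simp add: algebra_simps)
      finally show ?thesis .
    qed
    moreover have "(c * t + d) * (c * p + d) = (c * p + d)\<^sup>2 + c * (c * p + d) * (t - p)"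
      by (simp add: algebra_simps power2_eq_square)
    ultimately have "chart (f p) (f t) = ((c * p + d)\<^sup>2 + c * (c * p + d) * (t - p)) / (?\<Delta> * (t - p))"
      by (simp add: chart_def)
    also have "\<dots> = (c * p + d)\<^sup>2 / ?\<Delta> * chart p t + c * (c * p + d) / ?\<Delta>"
      using elim assms(2) by (simp add: chart_def add_divide_distrib)
    finally show ?case .
  qed
qed

text \<open>Projectivity is expressed by germs: one-sided at each point, which allows breakpoints,
  and affine at infinity, since affine maps are the projective maps fixing infinity.\<close>

definition piecewise_projective :: "(real \<Rightarrow> real) \<Rightarrow> bool" where
  "piecewise_projective f \<longleftrightarrow> strict_mono f \<and> surj f \<and>
    (\<forall>side\<in>{at_left, at_right}. \<forall>p. \<exists>\<alpha> \<beta>. \<alpha> \<noteq> 0 \<and> affine_germ (side p) (chart p) (chart (f p)) \<alpha> \<beta> f) \<and>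
    (\<forall>F\<in>{at_top, at_bot}. \<exists>\<alpha> \<beta>. \<alpha> \<noteq> 0 \<and> affine_germ F id id \<alpha> \<beta> f)"

lemma piecewise_projectiveD:
  assumes "piecewise_projective f"
  shows "strict_mono f" "surj f"
    and "side \<in> {at_left, at_right} \<Longrightarrow>
      \<exists>\<alpha> \<beta>. \<alpha> \<noteq> 0 \<and> affine_germ (side p) (chart p) (chart (f p)) \<alpha> \<beta> f"
    and "F \<in> {at_top, at_bot} \<Longrightarrow> \<exists>\<alpha> \<beta>. \<alpha> \<noteq> 0 \<and> affine_germ F id id \<alpha> \<beta> f"
  using assms by (simp_all only: piecewise_projective_def)

text \<open>A monotone surjection has no jumps and preserves sides, so germs can be composed and
  inverted on each side separately.\<close>

lemma filterlim_strict_mono_surj: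
  fixes f :: "real \<Rightarrow> real"
  assumes "strict_mono f" "surj f"
  shows "side \<in> {at_left, at_right} \<Longrightarrow> filterlim f (side (f p)) (side p)"
    and "F \<in> {at_top, at_bot} \<Longrightarrow> filterlim f F F"
    and "continuous_on UNIV f"
proof -
  have mono: "f x \<le> f y \<longleftrightarrow> x \<le> y" "f x < f y \<longleftrightarrow> x < y" "f x = f y \<longleftrightarrow> x = y" for x y
    using assms(1) by (simp_all add: strict_mono_less_eq strict_mono_less strict_mono_eq)
  show cont: "continuous_on UNIV f"
    using assms(2) by (intro continuous_onI_mono) (auto simp: mono)
  have "(f \<longlongrightarrow> f p) (at p)"
    using cont by (simp add: continuous_on_eq_continuous_at isCont_def)
  then have tend: "(f \<longlongrightarrow> f p) (at p within A)" for A
    using tendsto_within_subset by blast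
  show "filterlim f (side (f p)) (side p)" if "side \<in> {at_left, at_right}"
  proof (cases "side = at_left")
    case True
    then show ?thesis
      using tend by (auto simp: filterlim_at eventually_at_filter mono)
  next
    case False
    then have "side = at_right" using that by blast
    then show ?thesis
      using tend by (auto simp: filterlim_at eventually_at_filter mono)
  qed
  have "filterlim f at_top at_top"
    unfolding filterlim_at_top
  proof
    fix Z
    obtain z where z: "Z = f z"
      using assms(2) by (rule surjE)
    show "\<forall>\<^sub>F t in at_top. Z \<le> f t"
      using eventually_ge_at_top[of z] by eventually_elim (simp add: z mono)
  qed
  moreover have "filterlim f at_bot at_bot"
    unfolding filterlim_at_bot
  proof
    fix Z
    obtain z where z: "Z = f z"
      using assms(2) by (rule surjE)
    show "\<forall>\<^sub>F t in at_bot. f t \<le> Z"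
      using eventually_le_at_bot[of z] by eventually_elim (simp add: z mono)
  qed
  ultimately show "filterlim f F F" if "F \<in> {at_top, at_bot}"
    using that by blast
qed

section \<open>Closure of piecewise projective maps under the group operations\<close>

lemma piecewise_projective_id: "piecewise_projective id"
  unfolding piecewise_projective_def
proof (intro conjI ballI allI)
  show "\<exists>\<alpha> \<beta>. \<alpha> \<noteq> 0 \<and> affine_germ (side p) (chart p) (chart (id p)) \<alpha> \<beta> id" for side p
    using affine_germ_id[of "side p" "chart p"] by (intro exI[of _ 1] exI[of _ 0]) simp
  show "\<exists>\<alpha> \<beta>. \<alpha> \<noteq> 0 \<and> affine_germ F id id \<alpha> \<beta> id" for F
    using affine_germ_id[of F id] by (intro exI[of _ 1] exI[of _ 0]) simp
qed (auto simp: strict_mono_def)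

lemma piecewise_projective_comp:
  assumes f: "piecewise_projective f" and g: "piecewise_projective g"
  shows "piecewise_projective (g \<circ> f)"
  unfolding piecewise_projective_def
proof (intro conjI ballI allI)
  have mono: "strict_mono f" "surj f" "strict_mono g" "surj g"
    using f g by (simp_all add: piecewise_projective_def)
  show "strict_mono (g \<circ> f)"
    using mono by (simp add: strict_mono_def)
  show "surj (g \<circ> f)"
    using mono by (intro comp_surj)
  show "\<exists>\<alpha> \<beta>. \<alpha> \<noteq> 0 \<and> affine_germ (side p) (chart p) (chart ((g \<circ> f) p)) \<alpha> \<beta> (g \<circ> f)"
    if side: "side \<in> {at_left, at_right}" for side p
  proof -
    obtain \<alpha> \<beta> \<alpha>' \<beta>' where "\<alpha> \<noteq> 0" "affine_germ (side p) (chart p) (chart (f p)) \<alpha> \<beta> f"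
      and "\<alpha>' \<noteq> 0" "affine_germ (side (f p)) (chart (f p)) (chart (g (f p))) \<alpha>' \<beta>' g"
      using piecewise_projectiveD(3)[OF f side, of p] piecewise_projectiveD(3)[OF g side, of "f p"] by blast
    then show ?thesis
      using affine_germ_comp filterlim_strict_mono_surj(1)[OF mono(1,2) side]
      by (intro exI[of _ "\<alpha>' * \<alpha>"] exI[of _ "\<alpha>' * \<beta> + \<beta>'"]) auto
  qed
  show "\<exists>\<alpha> \<beta>. \<alpha> \<noteq> 0 \<and> affine_germ F id id \<alpha> \<beta> (g \<circ> f)" if F: "F \<in> {at_top, at_bot}" for F
  proof -
    obtain \<alpha> \<beta> \<alpha>' \<beta>' where "\<alpha> \<noteq> 0" "affine_germ F id id \<alpha> \<beta> f"
      and "\<alpha>' \<noteq> 0" "affine_germ F id id \<alpha>' \<beta>' g"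
      using piecewise_projectiveD(4)[OF f F] piecewise_projectiveD(4)[OF g F] by blast
    then show ?thesis
      using affine_germ_comp filterlim_strict_mono_surj(2)[OF mono(1,2) F]
      by (intro exI[of _ "\<alpha>' * \<alpha>"] exI[of _ "\<alpha>' * \<beta> + \<beta>'"]) auto
  qed
qed

lemma piecewise_projective_inverse:
  assumes f: "piecewise_projective f" and fg: "\<And>x. f (g x) = x"
  shows "piecewise_projective g"
  unfolding piecewise_projective_def
proof (intro conjI ballI allI)
  have mono: "strict_mono f" "surj f"
    using f by (simp_all add: piecewise_projective_def)
  have gf: "g (f x) = x" for x
    using strict_mono_eq[OF mono(1), of "g (f x)" x] fg by simp
  show g: "strict_mono g"
    by (rule strict_monoI) (metis fg mono(1) strict_mono_less)
  show "surj g"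
    using gf by (metis surjI)
  note lim = filterlim_strict_mono_surj[OF \<open>strict_mono g\<close> \<open>surj g\<close>]
  show "\<exists>\<alpha> \<beta>. \<alpha> \<noteq> 0 \<and> affine_germ (side p) (chart p) (chart (g p)) \<alpha> \<beta> g"
    if side: "side \<in> {at_left, at_right}" for side p
  proof -
    obtain \<alpha> \<beta> where "\<alpha> \<noteq> 0" "affine_germ (side (g p)) (chart (g p)) (chart (f (g p))) \<alpha> \<beta> f"
      using piecewise_projectiveD(3)[OF f side, of "g p"] by blast
    then show ?thesis
      using affine_germ_inverse[OF _ _ lim(1)[OF side] fg]
      by (intro exI[of _ "1 / \<alpha>"] exI[of _ "- \<beta> / \<alpha>"]) (simp add: fg)
  qed
  show "\<exists>\<alpha> \<beta>. \<alpha> \<noteq> 0 \<and> affine_germ F id id \<alpha> \<beta> g" if F: "F \<in> {at_top, at_bot}" for F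
  proof -
    obtain \<alpha> \<beta> where "\<alpha> \<noteq> 0" "affine_germ F id id \<alpha> \<beta> f"
      using piecewise_projectiveD(4)[OF f F] by blast
    then show ?thesis
      using affine_germ_inverse[OF _ _ lim(2)[OF F] fg]
      by (intro exI[of _ "1 / \<alpha>"] exI[of _ "- \<beta> / \<alpha>"]) simp
  qed
qed

section \<open>Projective germs of the generators\<close>

lemma moebius_germ_right:
  assumes "l \<le> p" "p < r" "\<And>t. \<lbrakk>l \<le> t; t \<le> r\<rbrakk> \<Longrightarrow> c * t + d \<noteq> 0 \<and> f t = (a * t + b) / (c * t + d)"
    and "a * d - b * c \<noteq> 0"
  shows "\<exists>\<alpha> \<beta>. \<alpha> \<noteq> 0 \<and> affine_germ (at_right p) (chart p) (chart (f p)) \<alpha> \<beta> f"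
proof -
  have "\<forall>\<^sub>F t in at_right p. f t = (a * t + b) / (c * t + d)"
    using eventually_at_right_real[OF assms(2)] by eventually_elim (use assms(1,3) in auto)
  \<comment> \<open>The piece is closed, so its formula also gives \<open>f p\<close> when
    \<open>p\<close> is its left endpoint.\<close>
  then have "affine_germ (at_right p) (chart p) (chart (f p)) ((c * p + d)\<^sup>2 / (a * d - b * c))
      (c * (c * p + d) / (a * d - b * c)) f"
    using assms(1,2,4) assms(3)[of p] by (intro moebius_affine_germ) (auto intro: at_le)
  then show ?thesis
    using assms(1,2,4) assms(3)[of p] by (intro exI conjI) auto
qed

lemma moebius_germ_left:
  assumes "l < p" "p \<le> r" "\<And>t. \<lbrakk>l \<le> t; t \<le> r\<rbrakk> \<Longrightarrow> c * t + d \<noteq> 0 \<and> f t = (a * t + b) / (c * t + d)"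
    and "a * d - b * c \<noteq> 0"
  shows "\<exists>\<alpha> \<beta>. \<alpha> \<noteq> 0 \<and> affine_germ (at_left p) (chart p) (chart (f p)) \<alpha> \<beta> f"
proof -
  have "\<forall>\<^sub>F t in at_left p. f t = (a * t + b) / (c * t + d)"
    using eventually_at_left_real[OF assms(1)] by eventually_elim (use assms(2,3) in auto)
  then have "affine_germ (at_left p) (chart p) (chart (f p)) ((c * p + d)\<^sup>2 / (a * d - b * c))
      (c * (c * p + d) / (a * d - b * c)) f"
    using assms(1,2,4) assms(3)[of p] by (intro moebius_affine_germ) (auto intro: at_le)
  then show ?thesis
    using assms(1,2,4) assms(3)[of p] by (intro exI conjI) auto
qed

text \<open>Two pieces are asked for at each point because they differ at a breakpoint. A
  translation near infinity is an affine germ with multiplier 1.\<close>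

lemma piecewise_projectiveI:
  assumes "f \<in> carrier Homeo_plus_R"
    and "\<And>p. \<exists>l r a b c d. l \<le> p \<and> p < r \<and> a * d - b * c \<noteq> 0 \<and>
      (\<forall>t. l \<le> t \<and> t \<le> r \<longrightarrow> c * t + d \<noteq> 0 \<and> f t = (a * t + b) / (c * t + d))"
    and "\<And>p. \<exists>l r a b c d. l < p \<and> p \<le> r \<and> a * d - b * c \<noteq> 0 \<and>
      (\<forall>t. l \<le> t \<and> t \<le> r \<longrightarrow> c * t + d \<noteq> 0 \<and> f t = (a * t + b) / (c * t + d))"
    and "\<exists>k m. \<forall>t\<ge>m. f t = t + k" "\<exists>k m. \<forall>t\<le>m. f t = t + k"
  shows "piecewise_projective f"
  unfolding piecewise_projective_def
proof (intro conjI ballI allI)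
  show "strict_mono f" "surj f"
    using assms(1) by (auto simp: Homeo_plus_R_def homeomorphism_def)
  show "\<exists>\<alpha> \<beta>. \<alpha> \<noteq> 0 \<and> affine_germ (side p) (chart p) (chart (f p)) \<alpha> \<beta> f"
    if "side \<in> {at_left, at_right}" for side p
  proof (cases "side = at_left")
    case True
    obtain l r a b c d where "l < p" "p \<le> r" "a * d - b * c \<noteq> 0"
      "\<forall>t. l \<le> t \<and> t \<le> r \<longrightarrow> c * t + d \<noteq> 0 \<and> f t = (a * t + b) / (c * t + d)"
      using assms(3)[of p] by blast
    then show ?thesis
      unfolding True by (intro moebius_germ_left[of l p r c d f a b]) auto
  next
    case False
    then have right: "side = at_right"
      using that by blast
    obtain l r a b c d where "l \<le> p" "p < r" "a * d - b * c \<noteq> 0"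
      "\<forall>t. l \<le> t \<and> t \<le> r \<longrightarrow> c * t + d \<noteq> 0 \<and> f t = (a * t + b) / (c * t + d)"
      using assms(2)[of p] by blast
    then show ?thesis
      unfolding right by (intro moebius_germ_right[of l p r c d f a b]) auto
  qed
  show "\<exists>\<alpha> \<beta>. \<alpha> \<noteq> 0 \<and> affine_germ F id id \<alpha> \<beta> f" if "F \<in> {at_top, at_bot}" for F
  proof -
    have "\<exists>k. \<forall>\<^sub>F t in F. f t = t + k"
      using that assms(4,5) unfolding eventually_at_top_linorder[symmetric] eventually_at_bot_linorder[symmetric]
      by blast
    then obtain k where "affine_germ F id id 1 k f"
      by (auto simp: affine_germ_def)
    then show ?thesis
      using zero_neq_one by metis
  qed
qed

lemma piecewise_projective_lm_a: "piecewise_projective lm_a"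
proof (rule piecewise_projectiveI)
  show "lm_a \<in> carrier Homeo_plus_R"
    using lm_generators_in_Homeo_plus_R by simp
  fix p
  show "\<exists>l r a b c d. l \<le> p \<and> p < r \<and> a * d - b * c \<noteq> 0 \<and>
      (\<forall>t. l \<le> t \<and> t \<le> r \<longrightarrow> c * t + d \<noteq> 0 \<and> lm_a t = (a * t + b) / (c * t + d))"
    by (rule exI[of _ p], rule exI[of _ "p + 1"], rule exI[of _ 1], rule exI[of _ 1], rule exI[of _ 0],
        rule exI[of _ 1]) (simp add: lm_a_def)
  show "\<exists>l r a b c d. l < p \<and> p \<le> r \<and> a * d - b * c \<noteq> 0 \<and>
      (\<forall>t. l \<le> t \<and> t \<le> r \<longrightarrow> c * t + d \<noteq> 0 \<and> lm_a t = (a * t + b) / (c * t + d))"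
    by (rule exI[of _ "p - 1"], rule exI[of _ p], rule exI[of _ 1], rule exI[of _ 1], rule exI[of _ 0],
        rule exI[of _ 1]) (simp add: lm_a_def)
qed (auto simp: lm_a_def)

text \<open>In the next two proofs, \<open>?P l r a b c d\<close> says that the generator is
  \<open>t \<mapsto> (a t + b) / (c t + d)\<close> on \<open>[l, r]\<close>.\<close>

lemma piecewise_projective_lm_b: "piecewise_projective lm_b"
proof (rule piecewise_projectiveI)
  show "lm_b \<in> carrier Homeo_plus_R"
    using lm_generators_in_Homeo_plus_R by simp
  let ?P = "\<lambda>l r a b c d. a * d - b * c \<noteq> 0 \<and>
      (\<forall>t. l \<le> t \<and> t \<le> r \<longrightarrow> c * t + d \<noteq> 0 \<and> lm_b t = (a * t + b) / (c * t + d))"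
  \<comment> \<open>At \<open>1/2\<close> the definition uses the preceding branch; both formulas
    give 1 there, so the piece can be closed.\<close>
  have middle: "lm_b t = 3 - 1 / t" if "1/2 \<le> t" "t \<le> 1" for t
  proof (cases "t \<le> 1/2")
    case True
    with that have t: "t = 1/2" by linarith
    show ?thesis
      unfolding t by (simp add: lm_b_def)
  qed (use that in \<open>simp add: lm_b_def\<close>)
  have pieces: "?P l 0 1 0 0 1" "?P 0 (1/2) 1 0 (-1) 1" "?P (1/2) 1 3 (-1) 1 0" "?P 1 r 1 1 0 1" for l r
  proof -
    show "?P (1/2) 1 3 (-1) 1 0"
      by (auto simp: middle diff_divide_distrib)
  qed (auto simp: lm_b_def)
  fix p :: real
  consider "p < 0" | "0 \<le> p" "p < 1/2" | "1/2 \<le> p" "p < 1" | "1 \<le> p" by linarith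
  then show "\<exists>l r a b c d. l \<le> p \<and> p < r \<and> ?P l r a b c d"
  proof cases
    case 1 with pieces(1)[of p] show ?thesis by blast
  next
    case 2 with pieces(2) show ?thesis by blast
  next
    case 3 with pieces(3) show ?thesis by blast
  next
    case 4 moreover have "p < p + 1" by simp
    ultimately show ?thesis using pieces(4)[of "p + 1"] by blast
  qed
  consider "p \<le> 0" | "0 < p" "p \<le> 1/2" | "1/2 < p" "p \<le> 1" | "1 < p" by linarith
  then show "\<exists>l r a b c d. l < p \<and> p \<le> r \<and> ?P l r a b c d"
  proof cases
    case 1 moreover have "p - 1 < p" by simp
    ultimately show ?thesis using pieces(1)[of "p - 1"] by blast
  next
    case 2 with pieces(2) show ?thesis by blast
  next
    case 3 with pieces(3) show ?thesis by blast
  next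
    case 4 with pieces(4)[of p] show ?thesis by blast
  qed
next
  show "\<exists>k m. \<forall>t\<ge>m. lm_b t = t + k"
    by (intro exI[of _ 1] exI[of _ 2]) (simp add: lm_b_def)
  show "\<exists>k m. \<forall>t\<le>m. lm_b t = t + k"
    by (intro exI[of _ 0]) (simp add: lm_b_def)
qed

lemma piecewise_projective_lm_c: "piecewise_projective lm_c"
proof (rule piecewise_projectiveI)
  show "lm_c \<in> carrier Homeo_plus_R"
    using lm_generators_in_Homeo_plus_R by simp
  let ?P = "\<lambda>l r a b c d. a * d - b * c \<noteq> 0 \<and>
      (\<forall>t. l \<le> t \<and> t \<le> r \<longrightarrow> c * t + d \<noteq> 0 \<and> lm_c t = (a * t + b) / (c * t + d))"
  have pieces: "?P l 0 1 0 0 1" "?P 0 1 2 0 1 1" "?P 1 r 1 0 0 1" for l r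
    by (auto simp: lm_c_def field_simps)
  fix p :: real
  consider "p < 0" | "0 \<le> p" "p < 1" | "1 \<le> p" by linarith
  then show "\<exists>l r a b c d. l \<le> p \<and> p < r \<and> ?P l r a b c d"
  proof cases
    case 1 with pieces(1)[of p] show ?thesis by blast
  next
    case 2 with pieces(2) show ?thesis by blast
  next
    case 3 moreover have "p < p + 1" by simp
    ultimately show ?thesis using pieces(3)[of "p + 1"] by blast
  qed
  consider "p \<le> 0" | "0 < p" "p \<le> 1" | "1 < p" by linarith
  then show "\<exists>l r a b c d. l < p \<and> p \<le> r \<and> ?P l r a b c d"
  proof cases
    case 1 moreover have "p - 1 < p" by simp
    ultimately show ?thesis using pieces(1)[of "p - 1"] by blast
  next
    case 2 with pieces(2) show ?thesis by blast
  next
    case 3 with pieces(3)[of p] show ?thesis by blast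
  qed
next
  show "\<exists>k m. \<forall>t\<ge>m. lm_c t = t + k"
    by (intro exI[of _ 0] exI[of _ 2]) (simp add: lm_c_def)
  show "\<exists>k m. \<forall>t\<le>m. lm_c t = t + k"
    by (intro exI[of _ 0] exI[of _ "-1"]) (simp add: lm_c_def)
qed

lemma piecewise_projective_Lodha_Moore_G0:
  assumes "f \<in> carrier Lodha_Moore_G0"
  shows "piecewise_projective f"
proof -
  have gen: "piecewise_projective h" if "h \<in> {lm_a, lm_b, lm_c}" for h
    using that piecewise_projective_lm_a piecewise_projective_lm_b piecewise_projective_lm_c by blast
  from assms have "f \<in> generate Homeo_plus_R {lm_a, lm_b, lm_c}"
    by (simp add: carrier_Lodha_Moore_G0)
  then show ?thesis
  proof induction
    case one
    then show ?case
      by (simp add: Homeo_plus_R_def piecewise_projective_id[unfolded id_def] piecewise_projective_id)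
  next
    case (incl h)
    then show ?case by (rule gen)
  next
    case (inv h)
    then have "h \<otimes>\<^bsub>Homeo_plus_R\<^esub> inv\<^bsub>Homeo_plus_R\<^esub> h = \<one>\<^bsub>Homeo_plus_R\<^esub>"
      using lm_generators_in_Homeo_plus_R by (intro group.r_inv[OF group_Homeo_plus_R]) blast
    then have "h ((inv\<^bsub>Homeo_plus_R\<^esub> h) x) = x" for x
      by (simp add: Homeo_plus_R_def fun_eq_iff)
    then show ?case
      by (rule piecewise_projective_inverse[OF gen[OF inv]])
  next
    case (eng h1 h2)
    have "h1 \<otimes>\<^bsub>Homeo_plus_R\<^esub> h2 = h1 \<circ> h2"
      by (simp add: Homeo_plus_R_def)
    with eng show ?case
      using piecewise_projective_comp[of h2 h1] by (simp only:)
  qed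
qed

section \<open>Groups of piecewise projective homeomorphisms\<close>

text \<open>Let \<open>r\<close> be the first point of \<open>C\<close> above \<open>p\<close>, or
  infinity if there is none. \<open>P\<close> holds on approach to \<open>r\<close>, so
  \<open>d\<close> can be chosen shortly before it.\<close>

lemma no_exit_above:
  fixes C :: "real set"
  assumes "closed C" "p \<notin> C" "\<And>r. r \<in> C \<Longrightarrow> \<forall>\<^sub>F t in at_left r. P t" "\<forall>\<^sub>F t in at_top. P t"
  shows "\<exists>d\<ge>p. {p..d} \<inter> C = {} \<and> (\<forall>t>d. {p..t} \<inter> C = {} \<longrightarrow> P t)"
proof (cases "C \<inter> {p..} = {}")
  case True
  obtain d where d: "\<And>t. t \<ge> d \<Longrightarrow> P t"
    using assms(4) by (auto simp: eventually_at_top_linorder)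
  show ?thesis
    using True d by (intro exI[of _ "max p d"]) auto
next
  case False
  define r where "r = Inf (C \<inter> {p..})"
  have bdd: "bdd_below (C \<inter> {p..})"
    by (rule bdd_belowI[of _ p]) simp
  have r: "r \<in> C \<inter> {p..}"
    unfolding r_def using False bdd assms(1) by (intro closed_contains_Inf closed_Int) auto
  have least: "r \<le> q" if "q \<in> C" "p \<le> q" for q
    unfolding r_def using bdd that by (intro cInf_lower) auto
  have "p < r"
    using r assms(2) by (metis Int_iff atLeast_iff order_le_less)
  obtain b where b: "b < r" "\<And>t. \<lbrakk>b < t; t < r\<rbrakk> \<Longrightarrow> P t"
    using assms(3)[of r] r by (auto simp: eventually_at_left[OF \<open>p < r\<close>])
  with \<open>p < r\<close> obtain d where d: "max p b < d" "d < r"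
    using dense[of "max p b" r] by auto
  show ?thesis
  proof (intro exI[of _ d] conjI allI impI)
    show "{p..d} \<inter> C = {}"
      using least d by force
    fix t assume "t > d" "{p..t} \<inter> C = {}"
    then have "t < r"
      using r by (metis Int_iff atLeastAtMost_iff atLeast_iff empty_iff not_le_imp_less)
    then show "P t"
      using b(2)[of t] d \<open>t > d\<close> by simp
  qed (use d in simp)
qed

text \<open>The mirror image of \<open>no_exit_above\<close> under
  \<open>t \<mapsto> - t\<close>.\<close>

lemma no_exit_below:
  fixes C :: "real set"
  assumes "closed C" "p \<notin> C" "\<And>r. r \<in> C \<Longrightarrow> \<forall>\<^sub>F t in at_right r. P t" "\<forall>\<^sub>F t in at_bot. P t"
  shows "\<exists>c\<le>p. {c..p} \<inter> C = {} \<and> (\<forall>t<c. {t..p} \<inter> C = {} \<longrightarrow> P t)"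
proof -
  have "\<forall>\<^sub>F t in at_left r. P (- t)" if "r \<in> uminus ` C" for r
    using that assms(3) by (auto simp: at_left_minus eventually_filtermap)
  moreover have "\<forall>\<^sub>F t in at_top. P (- t)"
    using assms(4) by (simp add: at_bot_mirror eventually_filtermap)
  moreover have "closed (uminus ` C)" "- p \<notin> uminus ` C"
    using assms(1,2) by (auto simp: closed_negations)
  ultimately obtain d where d: "d \<ge> - p" "{- p..d} \<inter> uminus ` C = {}"
    "\<And>t. \<lbrakk>t > d; {- p..t} \<inter> uminus ` C = {}\<rbrakk> \<Longrightarrow> P (- t)"
    using no_exit_above[of "uminus ` C" "- p" "\<lambda>t. P (- t)"] by auto
  have "{- p..- t} \<inter> uminus ` C = uminus ` ({t..p} \<inter> C)" for t
    by (simp add: image_Int)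
  then have flip: "{- p..- t} \<inter> uminus ` C = {} \<longleftrightarrow> {t..p} \<inter> C = {}" for t
    by (simp only: image_is_empty)
  show ?thesis
  proof (intro exI[of _ "- d"] conjI allI impI)
    show "{- d..p} \<inter> C = {}"
      using d(2) flip[of "- d"] by simp
    show "P t" if "t < - d" "{t..p} \<inter> C = {}" for t
      using d(3)[of "- t"] that flip by simp
  qed (use d(1) in simp)
qed

locale piecewise_projective_group =
  fixes H :: "(real \<Rightarrow> real) set" and G (structure)
  assumes G_def: "G = \<lparr>carrier = H, monoid.mult = (\<circ>), one = id\<rparr>"
    and group_G: "group G"
    and projective: "h \<in> H \<Longrightarrow> piecewise_projective h"
begin

sublocale group G
  by (rule group_G)

lemma G_simps [simp]: "carrier G = H" "x \<otimes> y = x \<circ> y" "\<one> = id"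
  by (simp_all add: G_def)

lemma H_comp: "\<lbrakk>x \<in> H; y \<in> H\<rbrakk> \<Longrightarrow> x \<circ> y \<in> H"
  using m_closed[of x y] by simp

lemma H_inv: "x \<in> H \<Longrightarrow> inv x \<in> H"
  using inv_closed[of x] by simp

lemma H_inv_apply [simp]:
  assumes "x \<in> H"
  shows "x ((inv x) t) = t" "(inv x) (x t) = t"
  using r_inv[of x] l_inv[of x] assms by (simp_all add: fun_eq_iff)

lemma H_mono:
  assumes "h \<in> H"
  shows "h s < h t \<longleftrightarrow> s < t" "h s \<le> h t \<longleftrightarrow> s \<le> t" "h s = h t \<longleftrightarrow> s = t"
  using piecewise_projectiveD(1)[OF projective[OF assms]]
  by (simp_all add: strict_mono_less strict_mono_less_eq strict_mono_eq)

section \<open>Germs at infinity and at the common fixed points\<close>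

definition fixed_points :: "real set" where
  "fixed_points = {p. \<forall>h\<in>H. h p = p}"

text \<open>Each filter comes with the coordinate in which germs there are affine. All elements of
  \<open>H\<close> preserve each filter, so these germs compose like affine maps.\<close>

definition ends :: "(real filter \<times> (real \<Rightarrow> real)) set" where
  "ends = {at_top, at_bot} \<times> {id} \<union> (\<Union>p\<in>fixed_points. {at_left p, at_right p} \<times> {chart p})"

lemma ends_cases [consumes 1, case_names infinite finite]:
  assumes "(F, u) \<in> ends"
  obtains "F \<in> {at_top, at_bot}" "u = id"
  | side p where "side \<in> {at_left, at_right}" "p \<in> fixed_points" "F = side p" "u = chart p"
  using assms unfolding ends_def by blast

lemma ends_germ:
  assumes "(F, u) \<in> ends" "h \<in> H"
  shows "\<exists>\<alpha> \<beta>. \<alpha> \<noteq> 0 \<and> affine_germ F u u \<alpha> \<beta> h"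
  using assms(1)
proof (cases rule: ends_cases)
  case infinite
  then show ?thesis
    using piecewise_projectiveD(4)[OF projective[OF assms(2)]] by blast
next
  case (finite side p)
  then have "h p = p"
    using assms(2) by (simp add: fixed_points_def)
  then show ?thesis
    using piecewise_projectiveD(3)[OF projective[OF assms(2)] finite(1), of p] finite by simp
qed

lemma ends_filterlim:
  assumes "(F, u) \<in> ends" "h \<in> H"
  shows "filterlim h F F"
proof -
  note mono = piecewise_projectiveD(1,2)[OF projective[OF assms(2)]]
  from assms(1) show ?thesis
  proof (cases rule: ends_cases)
    case infinite
    then show ?thesis
      using filterlim_strict_mono_surj(2)[OF mono] by blast
  next
    case (finite side p)
    then have "h p = p"
      using assms(2) by (simp add: fixed_points_def)
    then show ?thesis
      using filterlim_strict_mono_surj(1)[OF mono finite(1), of p] finite by simp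
  qed
qed

lemma ends_inj: "(F, u) \<in> ends \<Longrightarrow> inj u"
  by (auto simp: ends_def inj_chart)

lemma germ_mult:
  assumes "(F, u) \<in> ends" "h \<in> H" "affine_germ F u u \<alpha> \<beta> g" "affine_germ F u u \<alpha>' \<beta>' h"
  shows "affine_germ F u u (\<alpha> * \<alpha>') (\<alpha> * \<beta>' + \<beta>) (g \<circ> h)"
  using affine_germ_comp[OF assms(4,3) ends_filterlim[OF assms(1,2)]] .

lemma germ_inv:
  assumes "(F, u) \<in> ends" "h \<in> H" "affine_germ F u u \<alpha> \<beta> h" "\<alpha> \<noteq> 0"
  shows "affine_germ F u u (1 / \<alpha>) (- \<beta> / \<alpha>) (inv h)"
  using affine_germ_inverse[OF assms(3,4) ends_filterlim[OF assms(1) H_inv[OF assms(2)]]] assms(2)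
  by simp

text \<open>\<open>N1\<close> is the case \<open>B = UNIV\<close> and \<open>N2\<close> the case
  \<open>B = {0}\<close>.\<close>

definition translation_germs :: "real set \<Rightarrow> (real \<Rightarrow> real) set" where
  "translation_germs B = {h \<in> H. \<forall>(F, u)\<in>ends. \<exists>\<beta>\<in>B. affine_germ F u u 1 \<beta> h}"

lemma translation_germsD:
  assumes "x \<in> translation_germs B" "(F, u) \<in> ends"
  shows "\<exists>\<beta>\<in>B. affine_germ F u u 1 \<beta> x"
  using assms unfolding translation_germs_def by blast

text \<open>Conjugation by a germ with multiplier \<open>a\<close> multiplies the translation part
  by \<open>a\<close>, so closure of \<open>B\<close> under scaling yields normality.\<close>

lemma translation_germs_normal:
  assumes "subspace B"
  shows "translation_germs B \<lhd> G"
proof (intro normal_invI subgroupI)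
  note scale = subspace_scale[OF assms, unfolded real_scaleR_def]
  show "translation_germs B \<subseteq> carrier G"
    by (auto simp: translation_germs_def)
  have "id \<in> H"
    using one_closed by simp
  then have "id \<in> translation_germs B"
    using affine_germ_id subspace_0[OF assms] by (fastforce simp: translation_germs_def)
  then show "translation_germs B \<noteq> {}" by blast
  show "x \<otimes> y \<in> translation_germs B" if "x \<in> translation_germs B" "y \<in> translation_germs B" for x y
    unfolding translation_germs_def
  proof (intro CollectI conjI)
    have xy: "x \<in> H" "y \<in> H"
      using that by (auto simp: translation_germs_def)
    then show "x \<otimes> y \<in> H" by (simp add: H_comp)
    show "\<forall>(F, u)\<in>ends. \<exists>\<beta>\<in>B. affine_germ F u u 1 \<beta> (x \<otimes> y)"
    proof clarify
      fix F u assume e: "(F, u) \<in> ends"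
      from that obtain \<beta> \<beta>' where "\<beta> \<in> B" "affine_germ F u u 1 \<beta> x" "\<beta>' \<in> B" "affine_germ F u u 1 \<beta>' y"
        using translation_germsD[OF _ e] by meson
      then show "\<exists>\<beta>\<in>B. affine_germ F u u 1 \<beta> (x \<otimes> y)"
        using germ_mult[OF e xy(2), of 1 \<beta> x 1 \<beta>'] subspace_add[OF assms, of \<beta>' \<beta>] by auto
    qed
  qed
  show "inv x \<in> translation_germs B" if "x \<in> translation_germs B" for x
    unfolding translation_germs_def
  proof (intro CollectI conjI)
    have x: "x \<in> H"
      using that by (auto simp: translation_germs_def)
    then show "inv x \<in> H" by (rule H_inv)
    show "\<forall>(F, u)\<in>ends. \<exists>\<beta>\<in>B. affine_germ F u u 1 \<beta> (inv x)"
    proof clarify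
      fix F u assume e: "(F, u) \<in> ends"
      from that obtain \<beta> where "\<beta> \<in> B" "affine_germ F u u 1 \<beta> x"
        using translation_germsD[OF _ e] by meson
      then show "\<exists>\<beta>\<in>B. affine_germ F u u 1 \<beta> (inv x)"
        using germ_inv[OF e x, of 1 \<beta>] subspace_neg[OF assms, of \<beta>] by auto
    qed
  qed
  show "g \<otimes> x \<otimes> inv g \<in> translation_germs B" if "g \<in> carrier G" "x \<in> translation_germs B" for g x
    unfolding translation_germs_def
  proof (intro CollectI conjI)
    have x: "x \<in> H" and g: "g \<in> H" "inv g \<in> H"
      using that H_inv by (auto simp: translation_germs_def)
    then show "g \<otimes> x \<otimes> inv g \<in> H" by (simp add: H_comp)
    show "\<forall>(F, u)\<in>ends. \<exists>\<beta>\<in>B. affine_germ F u u 1 \<beta> (g \<otimes> x \<otimes> inv g)"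
    proof clarify
      fix F u assume e: "(F, u) \<in> ends"
      from that obtain \<beta> where \<beta>: "\<beta> \<in> B" "affine_germ F u u 1 \<beta> x"
        using translation_germsD[OF _ e] by meson
      obtain a b where a: "a \<noteq> 0" "affine_germ F u u a b g"
        using ends_germ[OF e g(1)] by blast
      have "affine_germ F u u (a * 1 * (1 / a)) (a * 1 * (- b / a) + (a * \<beta> + b)) (g \<circ> x \<circ> inv g)"
        using germ_mult[OF e g(2) germ_mult[OF e x a(2) \<beta>(2)] germ_inv[OF e g(1) a(2,1)]] .
      then have "affine_germ F u u 1 (a * \<beta>) (g \<otimes> x \<otimes> inv g)"
        using a(1) by simp
      then show "\<exists>\<beta>\<in>B. affine_germ F u u 1 \<beta> (g \<otimes> x \<otimes> inv g)"
        using scale[OF \<beta>(1)] by blast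
    qed
  qed
qed

text \<open>The affine group of the line is metabelian: multipliers cancel in a commutator, and the
  translation part vanishes as well when both multipliers are 1.\<close>

lemma commutator_germ:
  assumes e: "(F, u) \<in> ends" and H: "x \<in> H" "y \<in> H"
    and x: "affine_germ F u u \<alpha> \<beta> x" "\<alpha> \<noteq> 0" and y: "affine_germ F u u \<alpha>' \<beta>' y" "\<alpha>' \<noteq> 0"
  shows "affine_germ F u u 1 ((\<alpha> * \<beta>' + \<beta> - \<alpha>' * \<beta> - \<beta>') / (\<alpha> * \<alpha>')) (inv (y \<otimes> x) \<otimes> (x \<otimes> y))"
proof -
  have "affine_germ F u u (1 / (\<alpha>' * \<alpha>) * (\<alpha> * \<alpha>'))
      (1 / (\<alpha>' * \<alpha>) * (\<alpha> * \<beta>' + \<beta>) + - (\<alpha>' * \<beta> + \<beta>') / (\<alpha>' * \<alpha>)) (inv (y \<circ> x) \<circ> (x \<circ> y))"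
    using germ_mult[OF e H_comp[OF H] germ_inv[OF e H_comp[OF H(2,1)] germ_mult[OF e H(1) y(1) x(1)]]
        germ_mult[OF e H(2) x(1) y(1)]] x(2) y(2) by simp
  moreover have "1 / (\<alpha>' * \<alpha>) * (\<alpha> * \<beta>' + \<beta>) + - (\<alpha>' * \<beta> + \<beta>') / (\<alpha>' * \<alpha>)
      = (\<alpha> * \<beta>' + \<beta> - \<alpha>' * \<beta> - \<beta>') / (\<alpha> * \<alpha>')"
    by (simp add: diff_divide_distrib add_divide_distrib mult.commute)
  ultimately show ?thesis
    using x(2) y(2) by simp
qed

lemma commutator_in_H: "\<lbrakk>x \<in> H; y \<in> H\<rbrakk> \<Longrightarrow> inv (y \<otimes> x) \<otimes> (x \<otimes> y) \<in> H"
  by (simp add: H_comp H_inv)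

lemma commutator_translation_germs:
  assumes "x \<in> H" "y \<in> H"
  shows "inv (y \<otimes> x) \<otimes> (x \<otimes> y) \<in> translation_germs UNIV"
  unfolding translation_germs_def
proof (intro CollectI conjI)
  show "\<forall>(F, u)\<in>ends. \<exists>\<beta>\<in>UNIV. affine_germ F u u 1 \<beta> (inv (y \<otimes> x) \<otimes> (x \<otimes> y))"
  proof clarify
    fix F u assume e: "(F, u) \<in> ends"
    obtain \<alpha> \<beta> \<alpha>' \<beta>' where "\<alpha> \<noteq> 0" "affine_germ F u u \<alpha> \<beta> x"
      and "\<alpha>' \<noteq> 0" "affine_germ F u u \<alpha>' \<beta>' y"
      using ends_germ[OF e assms(1)] ends_germ[OF e assms(2)] by blast
    then show "\<exists>\<beta>\<in>UNIV. affine_germ F u u 1 \<beta> (inv (y \<otimes> x) \<otimes> (x \<otimes> y))"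
      using commutator_germ[OF e assms] by blast
  qed
qed (rule commutator_in_H[OF assms])

lemma commutator_trivial_germs:
  assumes "x \<in> translation_germs UNIV" "y \<in> translation_germs UNIV"
  shows "inv (y \<otimes> x) \<otimes> (x \<otimes> y) \<in> translation_germs {0}"
  unfolding translation_germs_def
proof (intro CollectI conjI)
  have H: "x \<in> H" "y \<in> H"
    using assms by (auto simp: translation_germs_def)
  then show "inv (y \<otimes> x) \<otimes> (x \<otimes> y) \<in> H"
    by (rule commutator_in_H)
  show "\<forall>(F, u)\<in>ends. \<exists>\<beta>\<in>{0}. affine_germ F u u 1 \<beta> (inv (y \<otimes> x) \<otimes> (x \<otimes> y))"
  proof clarify
    fix F u assume e: "(F, u) \<in> ends"
    obtain \<beta> \<beta>' where "affine_germ F u u 1 \<beta> x" "affine_germ F u u 1 \<beta>' y"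
      using translation_germsD[OF assms(1) e] translation_germsD[OF assms(2) e] by blast
    then show "\<exists>\<beta>\<in>{0}. affine_germ F u u 1 \<beta> (inv (y \<otimes> x) \<otimes> (x \<otimes> y))"
      using commutator_germ[OF e H, of 1 \<beta> 1 \<beta>'] by simp
  qed
qed

abbreviation trivial_germs :: "(real \<Rightarrow> real) set" where
  "trivial_germs \<equiv> translation_germs {0}"

lemma trivial_germsD:
  assumes "x \<in> trivial_germs" "(F, u) \<in> ends"
  shows "\<forall>\<^sub>F t in F. x t = t"
proof -
  have "\<forall>\<^sub>F t in F. u (x t) = u t"
    using assms by (auto simp: translation_germs_def affine_germ_def)
  then show ?thesis
    by eventually_elim (simp add: inj_eq[OF ends_inj[OF assms(2)]])
qed

lemma trivial_germs_subset: "trivial_germs \<subseteq> H"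
  by (auto simp: translation_germs_def)

section \<open>Complementary components of the fixed points, and displacement\<close>

lemma closed_fixed_points: "closed fixed_points"
proof -
  have "closed {p. h p = p}" if "h \<in> H" for h
    using filterlim_strict_mono_surj(3) piecewise_projectiveD(1,2)[OF projective[OF that]]
    by (intro closed_Collect_eq) (auto intro: continuous_intros)
  then show ?thesis
    unfolding fixed_points_def Collect_ball_eq by (intro closed_INT) blast
qed

text \<open>The connected component of \<open>p\<close> in the complement of the fixed points,
  phrased by order comparisons so that monotone maps visibly preserve it. It is empty when
  \<open>p\<close> is itself fixed.\<close>

definition component :: "real \<Rightarrow> real set" where
  "component p = {t. \<forall>q\<in>fixed_points. (q < p \<and> q < t) \<or> (p < q \<and> t < q)}"

lemma component_invariant:
  assumes "h \<in> H"
  shows "h t \<in> component p \<longleftrightarrow> t \<in> component p"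
proof -
  have "q < h t \<longleftrightarrow> q < t" "h t < q \<longleftrightarrow> t < q" if "q \<in> fixed_points" for q
  proof -
    have "h q = q"
      using that assms by (simp add: fixed_points_def)
    then show "q < h t \<longleftrightarrow> q < t" "h t < q \<longleftrightarrow> t < q"
      using H_mono(1)[OF assms, of q t] H_mono(1)[OF assms, of t q] by simp_all
  qed
  then show ?thesis
    by (simp add: component_def)
qed

text \<open>If no element moved \<open>c\<close> beyond \<open>d\<close>, the orbit of
  \<open>c\<close> would be bounded, and its supremum \<open>s\<close> would be a common fixed point
  in \<open>{c..d}\<close>.\<close>

lemma displacement:
  assumes "c \<le> d" "{c..d} \<inter> fixed_points = {}"
  shows "\<exists>h\<in>H. d < h c"
proof (rule ccontr)
  assume "\<not> ?thesis"
  then have le: "h c \<le> d" if "h \<in> H" for h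
    using that by force
  define s where "s = (SUP h\<in>H. h c)"
  have bdd: "bdd_above ((\<lambda>h. h c) ` H)"
    using le by (intro bdd_aboveI2)
  have id: "id \<in> H"
    using one_closed by simp
  have upper: "h c \<le> s" if "h \<in> H" for h
    unfolding s_def using that bdd by (rule cSUP_upper)
  \<comment> \<open>Each orbit point is the image under \<open>k\<close> of another orbit point,
    hence at most \<open>k s\<close>.\<close>
  have le_s: "s \<le> k s" if k: "k \<in> H" for k
  proof -
    have "(SUP h\<in>H. h c) \<le> k s"
    proof (rule cSUP_least)
      show "H \<noteq> {}" using id by blast
      fix h assume h: "h \<in> H"
      have "(inv k) (h c) \<le> s"
        using upper[OF H_comp[OF H_inv[OF k] h]] by simp
      then have "k ((inv k) (h c)) \<le> k s"
        by (simp add: H_mono(2)[OF k])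
      then show "h c \<le> k s"
        using k by simp
    qed
    then show ?thesis by (simp add: s_def)
  qed
  have "k s = s" if k: "k \<in> H" for k
  proof (rule antisym)
    have "k s \<le> k ((inv k) s)"
      using le_s[OF H_inv[OF k]] by (simp add: H_mono(2)[OF k])
    then show "k s \<le> s" using k by simp
  qed (rule le_s[OF k])
  then have "s \<in> fixed_points"
    by (simp add: fixed_points_def)
  moreover have "c \<le> s"
    using upper[OF id] by simp
  moreover have "s \<le> d"
    unfolding s_def using id le by (intro cSUP_least) auto
  ultimately show False
    using assms(2) by auto
qed

text \<open>Inside the component, \<open>u\<close> moves only points of \<open>{c..d}\<close>, while
  the conjugate \<open>w\<close> of \<open>v\<close> fixes all points up to \<open>d\<close>:
  \<open>inv g\<close> sends them below \<open>c\<close>, where \<open>v\<close> is trivial.\<close>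

lemma displaced_commute:
  assumes uv: "u \<in> H" "v \<in> H" and g: "g \<in> H" "d < g c"
    and u: "\<And>t. \<lbrakk>t \<in> component p; t \<notin> {c..d}\<rbrakk> \<Longrightarrow> u t = t"
    and v: "\<And>t. \<lbrakk>t \<in> component p; t \<notin> {c..d}\<rbrakk> \<Longrightarrow> v t = t"
    and t: "t \<in> component p"
  shows "u (g (v ((inv g) t))) = g (v ((inv g) (u t)))"
proof -
  define w where "w = g \<circ> v \<circ> inv g"
  have w: "w \<in> H"
    using uv(2) g(1) unfolding w_def by (intro H_comp H_inv)
  have below: "w s = s" if "s \<in> component p" "s \<le> d" for s
  proof -
    have "g ((inv g) s) < g c"
      using that g by simp
    then have "(inv g) s < c"
      by (simp only: H_mono(1)[OF g(1)])
    moreover have "(inv g) s \<in> component p"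
      using that component_invariant[OF H_inv[OF g(1)]] by simp
    ultimately have "v ((inv g) s) = (inv g) s"
      by (intro v) auto
    then show ?thesis
      using g(1) by (simp add: w_def)
  qed
  have above: "u s = s" if "s \<in> component p" "d < s" for s
    using that by (intro u) auto
  have "u (w t) = w (u t)"
  proof (cases "t \<le> d")
    case True
    have ut: "u t \<in> component p"
      using t component_invariant[OF uv(1)] by simp
    \<comment> \<open>A value beyond \<open>d\<close> would be fixed by \<open>u\<close>, and
      injectivity would then give \<open>u t = t\<close>.\<close>
    have "u t \<le> d"
    proof (rule ccontr)
      assume "\<not> u t \<le> d"
      then have "u (u t) = u t"
        using above ut by simp
      then show False
        using H_mono(3)[OF uv(1), of "u t" t] True \<open>\<not> u t \<le> d\<close> by simp
    qed
    then show ?thesis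
      using below t ut True by simp
  next
    case False
    have wt: "w t \<in> component p"
      using t component_invariant[OF w] by simp
    \<comment> \<open>Symmetrically, a value up to \<open>d\<close> would be fixed by
      \<open>w\<close>, forcing \<open>w t = t\<close>.\<close>
    have "d < w t"
    proof (rule ccontr)
      assume *: "\<not> d < w t"
      then have "w (w t) = w t"
        using below wt by simp
      then show False
        using H_mono(3)[OF w, of "w t" t] False * by simp
    qed
    then show ?thesis
      using above t wt False by simp
  qed
  then show ?thesis
    by (simp add: w_def)
qed

section \<open>Supports in finitely many components\<close>

definition supported_over :: "real set \<Rightarrow> (real \<Rightarrow> real) set" where
  "supported_over S = {x \<in> trivial_germs. \<forall>t. x t \<noteq> t \<longrightarrow> t \<in> (\<Union>p\<in>S. component p)}"

text \<open>Every element of \<open>H\<close> preserves each component, so conjugation cannot carry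
  a support into a new one.\<close>

lemma supported_over_normal: "supported_over S \<lhd> G"
proof -
  interpret N: normal trivial_germs G
    by (rule translation_germs_normal[OF subspace_single_0])
  have H: "x \<in> H" if "x \<in> supported_over S" for x
    using that trivial_germs_subset by (auto simp: supported_over_def)
  show ?thesis
  proof (intro normal_invI subgroupI)
    show "supported_over S \<subseteq> carrier G"
      using H by auto
    have "id \<in> supported_over S"
      using N.one_closed by (simp add: supported_over_def)
    then show "supported_over S \<noteq> {}" by blast
    show "x \<otimes> y \<in> supported_over S" if "x \<in> supported_over S" "y \<in> supported_over S" for x y
    proof -
      have "x (y t) = t" if "t \<notin> (\<Union>p\<in>S. component p)" for t
        using that \<open>x \<in> _\<close> \<open>y \<in> _\<close> unfolding supported_over_def by force
      moreover have "x \<otimes> y \<in> trivial_germs"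
        using that by (intro N.m_closed) (auto simp: supported_over_def)
      ultimately show ?thesis
        by (auto simp: supported_over_def)
    qed
    show "inv x \<in> supported_over S" if "x \<in> supported_over S" for x
    proof -
      have "(inv x) t = t" if "t \<notin> (\<Union>p\<in>S. component p)" for t
      proof -
        have "x t = t"
          using that \<open>x \<in> _\<close> unfolding supported_over_def by blast
        then show ?thesis
          using H_inv_apply(2)[OF H[OF \<open>x \<in> _\<close>], of t] by simp
      qed
      moreover have "inv x \<in> trivial_germs"
        using that by (intro N.m_inv_closed) (auto simp: supported_over_def)
      ultimately show ?thesis
        by (auto simp: supported_over_def)
    qed
    show "g \<otimes> x \<otimes> inv g \<in> supported_over S" if "g \<in> carrier G" "x \<in> supported_over S" for g x
    proof -
      have g: "g \<in> H" using that by simp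
      have "g (x ((inv g) t)) = t" if "t \<notin> (\<Union>p\<in>S. component p)" for t
      proof -
        have "(inv g) t \<notin> (\<Union>p\<in>S. component p)"
          using that component_invariant[OF H_inv[OF g]] by simp
        then have "x ((inv g) t) = (inv g) t"
          using \<open>x \<in> _\<close> unfolding supported_over_def by blast
        then show ?thesis
          using g by simp
      qed
      moreover have "g \<otimes> x \<otimes> inv g \<in> trivial_germs"
        using that by (intro N.inv_op_closed2) (auto simp: supported_over_def)
      ultimately show ?thesis
        by (auto simp: supported_over_def)
    qed
  qed
qed

lemma component_iff: "t \<in> component p \<longleftrightarrow> {min p t..max p t} \<inter> fixed_points = {}"
proof -
  have "(q < p \<and> q < t) \<or> (p < q \<and> t < q) \<longleftrightarrow> q \<notin> {min p t..max p t}" for q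
    by auto
  then show ?thesis
    unfolding component_def by blast
qed

text \<open>The component is bounded on each side by a fixed point or by infinity. Near these
  \<open>x\<close> is the identity, so its moved points stay within a compact interval.\<close>

lemma compact_support_in_component:
  assumes x: "x \<in> trivial_germs" and p: "p \<notin> fixed_points"
  shows "\<exists>c d. c \<le> p \<and> p \<le> d \<and> {c..d} \<inter> fixed_points = {} \<and>
    (\<forall>t\<in>component p. t \<notin> {c..d} \<longrightarrow> x t = t)"
proof -
  have germs: "\<forall>\<^sub>F t in at_left r. x t = t" "\<forall>\<^sub>F t in at_right r. x t = t" if "r \<in> fixed_points" for r
    using that by (auto intro!: trivial_germsD[OF x] simp: ends_def)
  have inf: "\<forall>\<^sub>F t in at_top. x t = t" "\<forall>\<^sub>F t in at_bot. x t = t"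
    by (auto intro!: trivial_germsD[OF x] simp: ends_def)
  obtain d where d: "p \<le> d" "{p..d} \<inter> fixed_points = {}"
    "\<And>t. \<lbrakk>t > d; {p..t} \<inter> fixed_points = {}\<rbrakk> \<Longrightarrow> x t = t"
    using no_exit_above[OF closed_fixed_points p germs(1) inf(1)] by blast
  obtain c where c: "c \<le> p" "{c..p} \<inter> fixed_points = {}"
    "\<And>t. \<lbrakk>t < c; {t..p} \<inter> fixed_points = {}\<rbrakk> \<Longrightarrow> x t = t"
    using no_exit_below[OF closed_fixed_points p germs(2) inf(2)] by blast
  have "{c..d} = {c..p} \<union> {p..d}"
    using c(1) d(1) by auto
  then have "{c..d} \<inter> fixed_points = {}"
    using c(2) d(2) by blast
  moreover have "x t = t" if "t \<in> component p" "t \<notin> {c..d}" for t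
  proof (cases "t < c")
    case True
    with that c(1) show ?thesis
      by (intro c(3)) (auto simp: component_iff)
  next
    case False
    with that d(1) show ?thesis
      by (intro d(3)) (auto simp: component_iff)
  qed
  ultimately show ?thesis
    using c(1) d(1) by blast
qed

text \<open>By compactness: \<open>x\<close> is the identity outside a bounded interval, and each
  \<open>p\<close> has a neighbourhood whose moved points lie in \<open>component p\<close>. The
  centres of a finite subcover form \<open>S\<close>.\<close>

lemma finitely_many_components:
  assumes x: "x \<in> trivial_germs"
  shows "\<exists>S. finite S \<and> x \<in> supported_over S"
proof -
  have loc: "\<exists>V. open V \<and> p \<in> V \<and> (\<forall>t\<in>V. x t \<noteq> t \<longrightarrow> t \<in> component p)" for p
  proof (cases "p \<in> fixed_points")
    \<comment> \<open>Here \<open>component p\<close> is empty, so a neighbourhood without moved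
      points is required; the two trivial one-sided germs provide it.\<close>
    case True
    have "\<forall>\<^sub>F t in at_left p. x t = t" "\<forall>\<^sub>F t in at_right p. x t = t"
      using True by (auto intro!: trivial_germsD[OF x] simp: ends_def)
    then have "\<forall>\<^sub>F t in at p. x t = t"
      by (simp add: eventually_at_split)
    moreover have "x p = p"
      using True x trivial_germs_subset by (auto simp: fixed_points_def)
    ultimately have "\<forall>\<^sub>F t in nhds p. x t = t"
      by (auto simp: eventually_at_filter elim: eventually_mono)
    then show ?thesis
      unfolding eventually_nhds by blast
  next
    case False
    then obtain e where e: "e > 0" "ball p e \<subseteq> - fixed_points"
      using closed_fixed_points by (meson ComplI open_Compl openE)
    have "t \<in> component p" if "t \<in> ball p e" for t
    proof -
      have "{min p t..max p t} \<subseteq> ball p e"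
        using that e(1) by (auto simp: dist_real_def)
      then show ?thesis
        using e(2) unfolding component_iff by blast
    qed
    then show ?thesis
      using e(1) by (intro exI[of _ "ball p e"]) auto
  qed
  then obtain V where V: "\<And>p. open (V p)" "\<And>p. p \<in> V p"
    "\<And>p t. \<lbrakk>t \<in> V p; x t \<noteq> t\<rbrakk> \<Longrightarrow> t \<in> component p"
    by metis
  have "\<forall>\<^sub>F t in at_top. x t = t" "\<forall>\<^sub>F t in at_bot. x t = t"
    by (auto intro!: trivial_germsD[OF x] simp: ends_def)
  then obtain a b where ab: "\<And>t. t \<ge> b \<Longrightarrow> x t = t" "\<And>t. t \<le> a \<Longrightarrow> x t = t"
    by (auto simp: eventually_at_top_linorder eventually_at_bot_linorder)
  obtain S where S: "finite S" "{a..b} \<subseteq> (\<Union>p\<in>S. V p)"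
    using compactE_image[of "{a..b}" UNIV V] V(1,2) by (metis UNIV_I UN_I compact_Icc subsetI)
  have "t \<in> (\<Union>p\<in>S. component p)" if "x t \<noteq> t" for t
  proof -
    have "t \<in> {a..b}"
      using ab that by (meson atLeastAtMost_iff nle_le)
    then show ?thesis
      using S(2) V(3) that by blast
  qed
  then show ?thesis
    using S(1) x by (auto simp: supported_over_def)
qed

lemma supported_over_mono: "S \<subseteq> T \<Longrightarrow> supported_over S \<subseteq> supported_over T"
  unfolding supported_over_def by blast

text \<open>A displacement in the component of \<open>p\<close> need not displace the supports in the other components, so
  the commutators below are trivial only over the component of \<open>p\<close>.\<close>

lemma supported_over_displaceable:
  assumes x: "x \<in> supported_over (insert p S)" and y: "y \<in> supported_over (insert p S)"
  shows "\<exists>g\<in>carrier G. \<forall>u\<in>{x, y, x \<otimes> y}. \<forall>v\<in>{x, y, x \<otimes> y}.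
    inv (g \<otimes> v \<otimes> inv g \<otimes> u) \<otimes> (u \<otimes> (g \<otimes> v \<otimes> inv g)) \<in> supported_over S"
proof -
  interpret M: normal "supported_over (insert p S)" G
    by (rule supported_over_normal)
  have id: "id \<in> H"
    using one_closed by simp
  have triv: "z \<in> trivial_germs" if "z \<in> supported_over (insert p S)" for z
    using that by (simp add: supported_over_def)
  have "\<exists>g\<in>H. \<forall>u\<in>{x, y, x \<otimes> y}. \<forall>v\<in>{x, y, x \<otimes> y}. \<forall>t\<in>component p.
      u (g (v ((inv g) t))) = g (v ((inv g) (u t)))"
  proof (cases "p \<in> fixed_points")
    \<comment> \<open>There is nothing to displace over an empty component, and the identity serves
      as conjugator.\<close>
    case True
    then have "component p = {}"
      by (auto simp: component_def)
    then show ?thesis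
      using id by blast
  next
    case False
    obtain c d where cd: "c \<le> p" "p \<le> d" "{c..d} \<inter> fixed_points = {}"
      "\<And>t. \<lbrakk>t \<in> component p; t \<notin> {c..d}\<rbrakk> \<Longrightarrow> x t = t"
      using compact_support_in_component[OF triv[OF x] False] by blast
    obtain c' d' where cd': "c' \<le> p" "p \<le> d'" "{c'..d'} \<inter> fixed_points = {}"
      "\<And>t. \<lbrakk>t \<in> component p; t \<notin> {c'..d'}\<rbrakk> \<Longrightarrow> y t = t"
      using compact_support_in_component[OF triv[OF y] False] by blast
    let ?c = "min c c'" and ?d = "max d d'"
    \<comment> \<open>Both intervals contain \<open>p\<close>, so together they cover the hull,
      which thus avoids the fixed points.\<close>
    have "{?c..?d} \<subseteq> {c..d} \<union> {c'..d'}"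
      using cd(1,2) cd'(1,2) by auto
    then have "{?c..?d} \<inter> fixed_points = {}"
      using cd(3) cd'(3) by blast
    moreover have "?c \<le> ?d"
      using cd(1,2) by linarith
    ultimately obtain g where g: "g \<in> H" "?d < g ?c"
      using displacement[of ?c ?d] by blast
    have outside: "u t = t" if "u \<in> {x, y, x \<otimes> y}" "t \<in> component p" "t \<notin> {?c..?d}" for u t
    proof -
      have "t \<notin> {c..d}" "t \<notin> {c'..d'}"
        using that(3) by auto
      then have "x t = t" "y t = t"
        using cd(4) cd'(4) that(2) by blast+
      then show ?thesis
        using that(1) by auto
    qed
    have "u \<in> H" if "u \<in> {x, y, x \<otimes> y}" for u
      using that M.mem_carrier[OF x] M.mem_carrier[OF y] H_comp by auto
    then show ?thesis
      using displaced_commute[OF _ _ g] outside g(1) by (intro bexI[of _ g] ballI) blast+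
  qed
  then obtain g where g: "g \<in> H" and comm: "\<And>u v t. \<lbrakk>u \<in> {x, y, x \<otimes> y}; v \<in> {x, y, x \<otimes> y};
      t \<in> component p\<rbrakk> \<Longrightarrow> u (g (v ((inv g) t))) = g (v ((inv g) (u t)))"
    by blast
  have "inv (w \<otimes> u) \<otimes> (u \<otimes> w) \<in> supported_over S"
    if u: "u \<in> {x, y, x \<otimes> y}" and v: "v \<in> {x, y, x \<otimes> y}" and w_def: "w = g \<otimes> v \<otimes> inv g" for u v w
  proof -
    have uv: "u \<in> supported_over (insert p S)" "v \<in> supported_over (insert p S)"
      using u v x y M.m_closed by blast+
    have w: "w \<in> supported_over (insert p S)"
      unfolding w_def using g uv by (intro M.inv_op_closed2) simp_all
    have H: "w \<otimes> u \<in> H"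
      using M.mem_carrier[OF w] M.mem_carrier[OF uv(1)] by (simp add: H_comp)
    let ?k = "inv (w \<otimes> u) \<otimes> (u \<otimes> w)"
    have k: "?k \<in> supported_over (insert p S)"
      using w uv by (intro M.m_closed M.m_inv_closed)
    \<comment> \<open>Normality confines \<open>?k\<close> to the components of
      \<open>insert p S\<close>; triviality over the component of \<open>p\<close> leaves those of
      \<open>S\<close>.\<close>
    have "?k t = t" if "t \<in> component p" for t
    proof -
      have "(u \<otimes> w) t = (w \<otimes> u) t"
        using comm[OF u v that] by (simp add: w_def)
      then have "?k t = (inv (w \<otimes> u)) ((w \<otimes> u) t)"
        by simp
      then show ?thesis
        using H_inv_apply(2)[OF H] by simp
    qed
    then show ?thesis
      using k by (auto simp: supported_over_def simp del: G_simps)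
  qed
  then show ?thesis
    using g by (intro bexI[of _ g]) (simp_all del: G_simps(2))
qed

section \<open>Splitting along the chain of normal subgroups\<close>

lemma cocycles_are_coboundaries: "bounded_2cocycles G \<subseteq> bounded_2coboundaries G"
proof
  fix \<omega> assume "\<omega> \<in> bounded_2cocycles G"
  then interpret bounded_cocycle G \<omega>
    by unfold_locales
  obtain \<phi> D where "homogenized_cocycle G \<omega> \<phi> D"
    by (rule homogenized_cocycle_exists)
  then interpret homogenized_cocycle G \<omega> \<phi> D .
  have finite: "splits_over (supported_over S)" if "finite S" for S
    using that
  proof induction
    case empty
    \<comment> \<open>With no component left, only the identity remains.\<close>
    have "supported_over {} \<subseteq> {\<one>}"
      by (auto simp: supported_over_def)
    then show ?case
      using splits_over_one unfolding splits_over_def by blast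
  next
    case (insert p S)
    show ?case
      by (rule splits_if_displaceable[OF supported_over_normal insert.IH supported_over_normal
            supported_over_displaceable])
  qed
  have "splits_over trivial_germs"
    unfolding splits_over_def
  proof (intro ballI)
    fix x y assume "x \<in> trivial_germs" "y \<in> trivial_germs"
    \<comment> \<open>\<open>splits_over\<close> is a condition on pairs, so a finite index set
      common to both elements is enough.\<close>
    then obtain S T where "finite S" "x \<in> supported_over S" "finite T" "y \<in> supported_over T"
      using finitely_many_components by meson
    then have "x \<in> supported_over (S \<union> T)" "y \<in> supported_over (S \<union> T)" "finite (S \<union> T)"
      using supported_over_mono[of S "S \<union> T"] supported_over_mono[of T "S \<union> T"] by auto
    then show "\<phi> (x \<otimes> y, 0) + \<omega> (x, y) = \<phi> (x, 0) + \<phi> (y, 0)"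
      using finite unfolding splits_over_def by blast
  qed
  \<comment> \<open>Commutators of translation germs are trivial, and commutators in
    \<open>H\<close> have translation germs: this gives the last two extensions.\<close>
  then have "splits_over (translation_germs UNIV)"
    using splits_if_commutators_in_normal[OF translation_germs_normal[OF subspace_single_0]]
      commutator_trivial_germs translation_germs_normal[OF subspace_UNIV]
    by (simp add: normal_imp_subgroup subgroup.subset del: G_simps)
  then have "splits_over (carrier G)"
    using splits_if_commutators_in_normal[OF translation_germs_normal[OF subspace_UNIV]]
      commutator_translation_germs by (simp del: G_simps(2,3))
  then show "\<omega> \<in> bounded_2coboundaries G"
    by (rule coboundary_if_splits)
qed

end

theorem mainTheorem7:
  fixes H :: "(real \<Rightarrow> real) set"
  assumes "subgroup H Lodha_Moore_G0"
  shows "trivial_group (second_bounded_cohomology (Lodha_Moore_G0\<lparr>carrier := H\<rparr>))"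
proof -
  have group: "group (Lodha_Moore_G0\<lparr>carrier := H\<rparr>)"
    using subgroup.subgroup_is_group[OF assms group_Lodha_Moore_G0] .
  have G: "Lodha_Moore_G0\<lparr>carrier := H\<rparr> = \<lparr>carrier = H, monoid.mult = (\<circ>), one = id\<rparr>"
    by (simp add: Lodha_Moore_G0_def subgroup_generated_def Homeo_plus_R_def)
  have "h \<in> carrier Lodha_Moore_G0" if "h \<in> H" for h
    using that subgroup.mem_carrier[OF assms] by blast
  then interpret piecewise_projective_group H "Lodha_Moore_G0\<lparr>carrier := H\<rparr>"
    using group piecewise_projective_Lodha_Moore_G0
    by (intro piecewise_projective_group.intro G) auto
  show ?thesis
    by (rule trivial_second_bounded_cohomologyI[OF group cocycles_are_coboundaries])
qed

end
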